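(* Let $w\in\mathfrak S_n$. There is a poset isomorphism $\Phi:R(w)\to\mathrm{SBT}(w)$ such that $\Phi(\rho)=R$ if and only if $\mathrm{perm}(\rho)=\mathrm{perm}(R)$. In particular, $\Phi$ preserves the rank.
   Context: $s_i$ is the simple transposition of $\mathfrak S_n$; acting on a permutation in one-line notation it exchanges the entries in positions $i$ and $i+1$. $\ell(u)$ is the number of inversions (pairs $i<j$ with $u_i>u_j$) of a permutation $u$. A reduced word for $w$ is $\rho=(\rho_\ell,\ldots,\rho_1)$, $\ell=\ell(w)$, with $w=s_{\rho_\ell}\cdots s_{\rho_1}\cdot\mathrm{id}$; $R(w)$ is the set of reduced words. Runs of $\rho$: maximal consecutive segments strictly increasing read left to right, $(\rho^{(k)}\mid\cdots\mid\rho^{(1)})$ from left to right; $\rho$ is super-Yamanouchi if every run consists of consecutive integers and $\min(\rho^{(k)})>\cdots>\min(\rho^{(1)})$; let $\pi=(\pi_\ell,\ldots,\pi_1)$ be the unique super-Yamanouchi reduced word for $w$. $\mathrm{perm}(\rho)=v_1\cdots v_\ell\in\mathfrak S_\ell$: positions of $\rho$ start unpaired; for $i=\ell,\ldots,1$: set $k:=\pi_i$, scan $j=\ell,\ldots,1$; if position $j$ is unpaired and $\rho_j=k$, pair $j$ with $i$, set $v_i:=j$, stop the scan; else if position $j$ is unpaired and $\rho_j=k-1$, set $k:=k-1$ and continue. $\mathrm{inv}(\rho)=\ell(\mathrm{perm}(\rho))-\sum_i(\pi_i-\rho_i)$. Coxeter moves on words: $\mathfrak c_i$ exchanges $\rho_i,\rho_{i+1}$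 if $|\rho_i-\rho_{i+1}|>1$, else identity; if $\rho_{i-1}=\rho_{i+1}=a$ and $\rho_i=a\pm1$, $\mathfrak b_i$ replaces the letters in positions $i+1,i,i-1$ by $a\pm1,a,a\pm1$, else identity. Rothe diagram $\mathbb D(w)=\{(i,w_j)\mid i<j,\ w_i>w_j\}$, cell $(i,w_j)$ in row $i$ (bottom to top) and column $w_j$. $\mathrm{SBT}(w)$: bijective fillings of $\mathbb D(w)$ with $\{1,\ldots,\ell\}$ such that for each cell, the number of larger entries to its right in its row equals the number of smaller entries above it in its column. Coxeter moves on tableaux: $\mathfrak c_i$ exchanges entries $i,i+1$ if they share neither row nor column, else identity; $\mathfrak b_i$ exchanges entries $i-1,i+1$ if one lies in the column of $i$ above it and the other in the row of $i$ to its right, else identity. $\mathrm{inv}(R)$ is the number of pairs of entries $i<j$ with $i$ in a strictly higher row and a different column than $j$. $\mathrm{perm}(R)$: sort each row of $R$ into decreasing order left to right, then read rows from bottom to top, each right to left, as a one-line permutation. Posets: on $R(w)$ (resp. $\mathrm{SBT}(w)$), the partial order is the transitive closure of $X>\mathfrak c_iX$ whenever $\mathrm{inv}(\mathfrak c_iX)=\mathrm{inv}(X)+1$ and $X>\mathfrak b_iX$ whenever $\mathrm{inv}(\mathfrak b_iX)=\mathrm{inv}(X)+1$; these are ranked posets with unique maximal element (the super-Yamanouchi element, of inversion number $0$), ranked by inversion number. *)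

theory Defs
  imports "HOL-Combinatorics.Permutations" "HOL-Library.FuncSet"
begin

text \<open>
  Elements of the symmetric group on \<open>{1..n}\<close> are functions \<open>w\<close> with \<open>w permutes {1..n}\<close>;
  \<open>w i\<close> is the \<open>i\<close>-th entry of the one-line notation.
\<close>

definition perm_length :: "nat \<Rightarrow> (nat \<Rightarrow> nat) \<Rightarrow> nat" where
  "perm_length n u = card {(i, j). 1 \<le> i \<and> i < j \<and> j \<le> n \<and> u i > u j}"

text \<open>Precomposition with the transposition exchanges the entries in positions \<open>i\<close> and \<open>i + 1\<close>.\<close>

definition simple_act :: "nat \<Rightarrow> (nat \<Rightarrow> nat) \<Rightarrow> nat \<Rightarrow> nat" where
  "simple_act i u = u \<circ> transpose i (Suc i)"


section \<open>Reduced words\<close>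

text \<open>
  A word \<open>(\<rho>\<^sub>l, \<dots>, \<rho>\<^sub>1)\<close> is the list \<open>[\<rho>\<^sub>l, \<dots>, \<rho>\<^sub>1]\<close>: its positions are numbered from
  right to left, starting with 1.
\<close>

definition letter :: "nat list \<Rightarrow> nat \<Rightarrow> nat" where
  "letter \<rho> i = \<rho> ! (length \<rho> - i)"

definition set_letter :: "nat \<Rightarrow> nat \<Rightarrow> nat list \<Rightarrow> nat list" where
  "set_letter i a \<rho> = \<rho>[length \<rho> - i := a]"

definition reduced_words :: "nat \<Rightarrow> (nat \<Rightarrow> nat) \<Rightarrow> nat list set" where
  "reduced_words n w =
     {\<rho>. set \<rho> \<subseteq> {1..<n} \<and> length \<rho> = perm_length n w \<and> foldr simple_act \<rho> id = w}"

fun runs :: "nat list \<Rightarrow> nat list list" where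
  "runs [] = []"
| "runs [a] = [[a]]"
| "runs (a # b # \<rho>) =
     (if a < b then (a # hd (runs (b # \<rho>))) # tl (runs (b # \<rho>)) else [a] # runs (b # \<rho>))"

definition super_yamanouchi :: "nat list \<Rightarrow> bool" where
  "super_yamanouchi \<rho> \<longleftrightarrow>
     (\<forall>r \<in> set (runs \<rho>). successively (\<lambda>a b. b = Suc a) r) \<and>
     sorted_wrt (>) (map (\<lambda>r. Min (set r)) (runs \<rho>))"

definition sy_word :: "nat \<Rightarrow> (nat \<Rightarrow> nat) \<Rightarrow> nat list" where
  "sy_word n w = (THE \<pi>. \<pi> \<in> reduced_words n w \<and> super_yamanouchi \<pi>)"

text \<open>
  \<open>scan \<rho> P k j\<close> performs the scan over the positions \<open>j, \<dots>, 1\<close> with current value \<open>k\<close>, where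
  \<open>P\<close> is the set of positions already paired.  It returns the position to be paired, or the dummy
  value 0 if the scan ends without pairing (which does not happen for reduced words of \<open>w\<close> and
  their super-Yamanouchi word).
\<close>

fun scan :: "nat list \<Rightarrow> nat set \<Rightarrow> nat \<Rightarrow> nat \<Rightarrow> nat" where
  "scan \<rho> P k 0 = 0"
| "scan \<rho> P k (Suc j) =
     (if Suc j \<notin> P \<and> letter \<rho> (Suc j) = k then Suc j
      else if Suc j \<notin> P \<and> letter \<rho> (Suc j) + 1 = k then scan \<rho> P (k - 1) j
      else scan \<rho> P k j)"

text \<open>
  Processing \<open>[\<pi>\<^sub>l, \<dots>, \<pi>\<^sub>1]\<close> from the left, this yields \<open>[v\<^sub>l, \<dots>, v\<^sub>1]\<close>.
\<close>

fun pairing :: "nat list \<Rightarrow> nat set \<Rightarrow> nat list \<Rightarrow> nat list" where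
  "pairing \<rho> P [] = []"
| "pairing \<rho> P (k # ks) =
     (let j = scan \<rho> P k (length \<rho>) in j # pairing \<rho> (insert j P) ks)"

definition word_perm :: "nat \<Rightarrow> (nat \<Rightarrow> nat) \<Rightarrow> nat list \<Rightarrow> nat \<Rightarrow> nat" where
  "word_perm n w \<rho> =
     (\<lambda>i. if i \<in> {1..perm_length n w} then letter (pairing \<rho> {} (sy_word n w)) i else i)"

definition word_inv :: "nat \<Rightarrow> (nat \<Rightarrow> nat) \<Rightarrow> nat list \<Rightarrow> int" where
  "word_inv n w \<rho> =
     int (perm_length (perm_length n w) (word_perm n w \<rho>))
     - (\<Sum>i = 1..perm_length n w. int (letter (sy_word n w) i) - int (letter \<rho> i))"

definition word_c :: "nat \<Rightarrow> nat list \<Rightarrow> nat list" where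
  "word_c i \<rho> =
     (if \<bar>int (letter \<rho> i) - int (letter \<rho> (i + 1))\<bar> > 1
      then set_letter i (letter \<rho> (i + 1)) (set_letter (i + 1) (letter \<rho> i) \<rho>)
      else \<rho>)"

definition word_b :: "nat \<Rightarrow> nat list \<Rightarrow> nat list" where
  "word_b i \<rho> =
     (if letter \<rho> (i - 1) = letter \<rho> (i + 1) \<and> \<bar>int (letter \<rho> i) - int (letter \<rho> (i + 1))\<bar> = 1
      then set_letter (i + 1) (letter \<rho> i)
            (set_letter i (letter \<rho> (i + 1)) (set_letter (i - 1) (letter \<rho> i) \<rho>))
      else \<rho>)"


section \<open>Standard balanced tableaux\<close>

text \<open>
  A cell is a pair (row, column); rows are numbered from bottom to top, columns from left to right.
\<close>

definition rothe :: "nat \<Rightarrow> (nat \<Rightarrow> nat) \<Rightarrow> (nat \<times> nat) set" where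
  "rothe n w = {(i, w j) | i j. 1 \<le> i \<and> i < j \<and> j \<le> n \<and> w i > w j}"

text \<open>
  Fillings are extensional functions, so that a tableau is determined by its entries in the diagram.
\<close>

definition SBT :: "nat \<Rightarrow> (nat \<Rightarrow> nat) \<Rightarrow> (nat \<times> nat \<Rightarrow> nat) set" where
  "SBT n w =
     {T. T \<in> extensional (rothe n w) \<and> bij_betw T (rothe n w) {1..perm_length n w} \<and>
         (\<forall>(r, c) \<in> rothe n w.
            card {c'. (r, c') \<in> rothe n w \<and> c < c' \<and> T (r, c) < T (r, c')} =
            card {r'. (r', c) \<in> rothe n w \<and> r < r' \<and> T (r', c) < T (r, c)})}"

definition exchange ::
  "(nat \<times> nat) set \<Rightarrow> nat \<Rightarrow> nat \<Rightarrow> (nat \<times> nat \<Rightarrow> nat) \<Rightarrow> (nat \<times> nat \<Rightarrow> nat)" where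
  "exchange D a b T = restrict (transpose a b \<circ> T) D"

definition tab_c ::
  "(nat \<times> nat) set \<Rightarrow> nat \<Rightarrow> (nat \<times> nat \<Rightarrow> nat) \<Rightarrow> (nat \<times> nat \<Rightarrow> nat)" where
  "tab_c D i T =
     (let x = the_inv_into D T i; y = the_inv_into D T (i + 1)
      in if fst x \<noteq> fst y \<and> snd x \<noteq> snd y then exchange D i (i + 1) T else T)"

definition above :: "nat \<times> nat \<Rightarrow> nat \<times> nat \<Rightarrow> bool" where
  "above x y \<longleftrightarrow> snd x = snd y \<and> fst x > fst y"

definition right_of :: "nat \<times> nat \<Rightarrow> nat \<times> nat \<Rightarrow> bool" where
  "right_of x y \<longleftrightarrow> fst x = fst y \<and> snd x > snd y"

definition tab_b ::
  "(nat \<times> nat) set \<Rightarrow> nat \<Rightarrow> (nat \<times> nat \<Rightarrow> nat) \<Rightarrow> (nat \<times> nat \<Rightarrow> nat)" where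
  "tab_b D i T =
     (let x = the_inv_into D T (i - 1); y = the_inv_into D T i; z = the_inv_into D T (i + 1)
      in if above x y \<and> right_of z y \<or> above z y \<and> right_of x y
         then exchange D (i - 1) (i + 1) T else T)"

definition tab_inv :: "(nat \<times> nat) set \<Rightarrow> (nat \<times> nat \<Rightarrow> nat) \<Rightarrow> int" where
  "tab_inv D T =
     int (card {(x, y). x \<in> D \<and> y \<in> D \<and> T x < T y \<and> fst x > fst y \<and> snd x \<noteq> snd y})"

text \<open>
  A row sorted into decreasing order and then read from right to left is read in increasing order.
\<close>

definition tab_reading :: "nat \<Rightarrow> (nat \<Rightarrow> nat) \<Rightarrow> (nat \<times> nat \<Rightarrow> nat) \<Rightarrow> nat list" where
  "tab_reading n w T =
     concat (map (\<lambda>r. sorted_list_of_set (T ` {x \<in> rothe n w. fst x = r})) [1..<Suc n])"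

definition tab_perm :: "nat \<Rightarrow> (nat \<Rightarrow> nat) \<Rightarrow> (nat \<times> nat \<Rightarrow> nat) \<Rightarrow> nat \<Rightarrow> nat" where
  "tab_perm n w T =
     (\<lambda>i. if i \<in> {1..perm_length n w} then tab_reading n w T ! (i - 1) else i)"


section \<open>The posets\<close>

text \<open>
  A pair \<open>(Y, X)\<close> in the relation means \<open>Y \<le> X\<close>; the generating relations are \<open>c i X < X\<close> and
  \<open>b i X < X\<close> whenever the move increases the inversion number \<open>f\<close> by one.
  The parameter \<open>l\<close> is the length of the words (the number of entries of the tableaux) and bounds the indices of the moves.
\<close>

definition move_step ::
  "'a set \<Rightarrow> nat \<Rightarrow> (nat \<Rightarrow> 'a \<Rightarrow> 'a) \<Rightarrow> (nat \<Rightarrow> 'a \<Rightarrow> 'a) \<Rightarrow> ('a \<Rightarrow> int) \<Rightarrow> 'a rel" where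
  "move_step A l c b f =
     {(Y, X) \<in> A \<times> A. f Y = f X + 1 \<and>
        ((\<exists>i. 1 \<le> i \<and> i < l \<and> Y = c i X) \<or> (\<exists>i. 1 < i \<and> i < l \<and> Y = b i X))}"

definition move_order ::
  "'a set \<Rightarrow> nat \<Rightarrow> (nat \<Rightarrow> 'a \<Rightarrow> 'a) \<Rightarrow> (nat \<Rightarrow> 'a \<Rightarrow> 'a) \<Rightarrow> ('a \<Rightarrow> int) \<Rightarrow> 'a rel" where
  "move_order A l c b f = (move_step A l c b f)\<^sup>* \<inter> A \<times> A"

definition word_order :: "nat \<Rightarrow> (nat \<Rightarrow> nat) \<Rightarrow> nat list rel" where
  "word_order n w =
     move_order (reduced_words n w) (perm_length n w) word_c word_b (word_inv n w)"

definition tab_order :: "nat \<Rightarrow> (nat \<Rightarrow> nat) \<Rightarrow> (nat \<times> nat \<Rightarrow> nat) rel" where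
  "tab_order n w =
     move_order (SBT n w) (perm_length n w) (tab_c (rothe n w)) (tab_b (rothe n w))
       (tab_inv (rothe n w))"

definition poset_iso :: "'a set \<Rightarrow> 'a rel \<Rightarrow> 'b set \<Rightarrow> 'b rel \<Rightarrow> ('a \<Rightarrow> 'b) \<Rightarrow> bool" where
  "poset_iso A r B s \<phi> \<longleftrightarrow>
     partial_order_on A r \<and> partial_order_on B s \<and> bij_betw \<phi> A B \<and>
     (\<forall>x \<in> A. \<forall>y \<in> A. (x, y) \<in> r \<longleftrightarrow> (\<phi> x, \<phi> y) \<in> s)"

end

theory Submission
  imports Defs
begin

text \<open>
  A reduced word sorts the identity into \<open>w\<close> by adjacent exchanges, and \<open>\<Phi> \<rho>\<close> records in the cell
  (position of \<open>b\<close> in \<open>w\<close>, \<open>a\<close>) the time at which the values \<open>a < b\<close> are exchanged.  Prepending a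
  letter \<open>k\<close> swaps rows \<open>k\<close> and \<open>k + 1\<close> of the diagram and adds one cell with the largest entry.
  Conversely the largest entry of a balanced tableau lies in a cell \<open>(k, w (k + 1))\<close>, and deleting it
  leaves a balanced tableau, so \<open>\<Phi>\<close> is bijective.  Coxeter moves only involve consecutive times,
  hence correspond.

  For the permutations, the super-Yamanouchi word of \<open>w\<close> starts with the last descent \<open>k\<close> of \<open>w\<close>,
  followed by the super-Yamanouchi word of \<open>w s\<^sub>k\<close>.  A scan of the pairing algorithm follows the
  value \<open>w k\<close> back in time until it finds the largest entry of row \<open>k\<close>; deleting this letter gives a
  reduced word of \<open>w s\<^sub>k\<close> whose tableau has the same row contents otherwise.  For the inversion
  numbers, the letter sum of \<open>\<rho>\<close> plus the number of column inversions of \<open>\<Phi> \<rho>\<close> depends only on \<open>w\<close>.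
\<close>

text \<open>Deleting the largest entry, in the cell \<open>(k, w (k + 1))\<close>, and swapping rows
  \<open>k\<close> and \<open>k + 1\<close> lowers the two counts of the balance condition at the
  same cells, but only if every column meeting row \<open>k + 1\<close> has a smaller entry there
  than in row \<open>k\<close>. For the tableau of a word this holds because two values that are
  never exchanged are passed in their order by any smaller value. For an arbitrary balanced tableau
  it has to be extracted from the balance condition (\<open>SBT_max_rows\<close>), and this is the
  crux of surjectivity.

  The rank statement rests on one count: the length of the reading permutation counts all pairs with
  the smaller entry in a higher row, while \<open>tab_inv\<close> leaves out the pairs in a common
  column. So the column inversions must equal the sum of the differences between the letters of the
  super-Yamanouchi word and those of \<open>\<rho>\<close>. The letter sum plus the column
  inversions is independent of the word because a prepended \<open>k\<close> raises it by
  \<open>k\<close> plus the size of row \<open>k\<close> of the old diagram, whichever word came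
  before. The super-Yamanouchi word has no column inversions, since it always acts where that row is
  empty.\<close>

declare One_nat_def [simp del]

lemma add_one_nat [simp]: "n + 1 = Suc n" by simp

lemma transpose_eq_simps [simp]:
  "transpose a b i = transpose a b j \<longleftrightarrow> i = j"
  "transpose a b i = a \<longleftrightarrow> i = b" "transpose a b i = b \<longleftrightarrow> i = a"
  "a = transpose a b i \<longleftrightarrow> i = b" "b = transpose a b i \<longleftrightarrow> i = a"
  by (auto simp: transpose_def)

section \<open>Action of words, length and reducedness\<close>

definition word_act :: "nat list \<Rightarrow> nat \<Rightarrow> nat" where
  "word_act \<rho> = foldr simple_act \<rho> id"

lemma word_act_Nil [simp]: "word_act [] = id"
  and word_act_Cons [simp]: "word_act (k # \<rho>) = simple_act k (word_act \<rho>)"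
  by (simp_all add: word_act_def)

lemma simple_act_apply: "simple_act k u i = u (transpose k (Suc k) i)"
  by (simp add: simple_act_def)

lemma simple_act_simple_act [simp]: "simple_act k (simple_act k u) = u"
  by (simp add: simple_act_def fun_eq_iff)

lemma simple_act_permutes:
  assumes "u permutes {1..n}" "k \<in> {1..<n}"
  shows "simple_act k u permutes {1..n}"
  unfolding simple_act_def
  using assms by (intro permutes_compose permutes_swap_id) auto

lemma word_act_permutes:
  "set \<rho> \<subseteq> {1..<n} \<Longrightarrow> word_act \<rho> permutes {1..n}"
proof (induction \<rho>)
  case (Cons k \<rho>)
  then show ?case using simple_act_permutes[of "word_act \<rho>" n k] by auto
qed (simp add: permutes_id)

text \<open>No index lies strictly between \<open>k\<close> and \<open>Suc k\<close>, so an adjacent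
  transposition disturbs the order of that one pair only.\<close>

lemma transpose_Suc_less_iff:
  "{i, j} \<noteq> {k, Suc k} \<Longrightarrow> transpose k (Suc k) i < transpose k (Suc k) j \<longleftrightarrow> i < j"
  by (auto simp: transpose_def)

lemma transpose_Suc_bounds:
  "k \<in> {1..<n} \<Longrightarrow> transpose k (Suc k) i \<in> {1..n} \<longleftrightarrow> i \<in> {1..n}"
  by (auto simp: transpose_def)

lemma perm_length_finite:
  "finite {(i :: nat, j). 1 \<le> i \<and> i < j \<and> j \<le> n \<and> u i > (u j :: nat)}"
  by (rule finite_subset[of _ "{..n} \<times> {..n}"]) auto

text \<open>Relabelling positions carries the inversions of \<open>u\<close> to inversions of the
  new permutation, and the ascent at \<open>k\<close> contributes the single new one
  \<open>(k, Suc k)\<close>.\<close>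

lemma perm_length_simple_act:
  assumes k: "k \<in> {1..<n}" and less: "u k < u (Suc k)"
  shows "perm_length n (simple_act k u) = Suc (perm_length n u)"
proof -
  let ?s = "transpose k (Suc k)"
  let ?I = "\<lambda>u :: nat \<Rightarrow> nat. {(i, j). 1 \<le> i \<and> i < j \<and> j \<le> n \<and> u i > u j}"
  have "?I (simple_act k u) = insert (k, Suc k) (map_prod ?s ?s ` ?I u)"
  proof (intro equalityI subsetI)
    fix x assume "x \<in> ?I (simple_act k u)"
    then obtain i j where x: "x = (i, j)" "1 \<le> i" "i < j" "j \<le> n" "u (?s i) > u (?s j)"
      by (auto simp: simple_act_apply)
    show "x \<in> insert (k, Suc k) (map_prod ?s ?s ` ?I u)"
    proof (cases "{i, j} = {k, Suc k}")
      case True then show ?thesis using x by (auto simp: doubleton_eq_iff)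
    next
      case False
      then have "?s i < ?s j" using x transpose_Suc_less_iff by blast
      moreover have "?s i \<in> {1..n}" "?s j \<in> {1..n}"
        using x transpose_Suc_bounds[OF k] by auto
      ultimately have "(?s i, ?s j) \<in> ?I u" using x by auto
      then have "map_prod ?s ?s (?s i, ?s j) \<in> map_prod ?s ?s ` ?I u" by (rule imageI)
      then show ?thesis using x by simp
    qed
  next
    fix x assume "x \<in> insert (k, Suc k) (map_prod ?s ?s ` ?I u)"
    then consider "x = (k, Suc k)" | i j where "x = (?s i, ?s j)" "(i, j) \<in> ?I u" by auto
    then show "x \<in> ?I (simple_act k u)"
    proof cases
      case 1 then show ?thesis using k less by (auto simp: simple_act_apply)
    next
      case 2
      then have "{i, j} \<noteq> {k, Suc k}" using less by (auto simp: doubleton_eq_iff)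
      then have "?s i < ?s j" using 2 transpose_Suc_less_iff by auto
      moreover have "?s i \<in> {1..n}" "?s j \<in> {1..n}"
        using 2 transpose_Suc_bounds[OF k] by auto
      ultimately show ?thesis using 2 by (auto simp: simple_act_apply)
    qed
  qed
  moreover have "(k, Suc k) \<notin> map_prod ?s ?s ` ?I u"
  proof
    assume "(k, Suc k) \<in> map_prod ?s ?s ` ?I u"
    then obtain i j where "k = ?s i" "Suc k = ?s j" "i < j" by auto
    then show False by simp
  qed
  moreover have "card (map_prod ?s ?s ` ?I u) = card (?I u)"
    by (rule card_image) (auto simp: inj_on_def)
  moreover have "finite (map_prod ?s ?s ` ?I u)" using perm_length_finite by blast
  ultimately show ?thesis unfolding perm_length_def by simp
qed

lemma perm_length_simple_act_descent:
  assumes k: "k \<in> {1..<n}" and less: "u k > u (Suc k)"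
  shows "perm_length n u = Suc (perm_length n (simple_act k u))"
  using perm_length_simple_act[OF k, of "simple_act k u"] less
  by (simp add: simple_act_apply)

lemma permutes_increasing_id:
  assumes p: "w permutes {1..n}" and inc: "\<And>k. k \<in> {1..<n} \<Longrightarrow> w k < w (Suc k)"
  shows "w = id"
proof -
  have "i \<le> w i" if "i \<in> {1..n}" for i
    using that
  proof (induction i)
    case (Suc i)
    show ?case
    proof (cases "i = 0")
      case True
      then show ?thesis using permutes_in_image[OF p, of 1] Suc.prems by (simp add: One_nat_def)
    next
      case False
      then have "i \<le> w i" "w i < w (Suc i)" using Suc inc[of i] by auto
      then show ?thesis by simp
    qed
  qed simp
  then show ?thesis using permutes_natset_ge[OF p] by blast
qed

lemma permutes_less_or_greater:
  assumes "w permutes {1..n}"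
  shows "w k < w (Suc k) \<or> w k > w (Suc k)"
proof -
  have "w k \<noteq> w (Suc k)" using permutes_inj[OF assms] by (auto simp: inj_eq)
  then show ?thesis by linarith
qed

lemma exists_descent:
  assumes p: "w permutes {1..n}" and "w \<noteq> id"
  obtains k where "k \<in> {1..<n}" "w k > w (Suc k)"
  using permutes_increasing_id[OF p] permutes_less_or_greater[OF p] assms(2) by blast

text \<open>Reducedness without a prescribed target: the tail of a reduced word is reduced for its
  own permutation, which lets inductions drop the head letter.\<close>

definition is_reduced :: "nat \<Rightarrow> nat list \<Rightarrow> bool" where
  "is_reduced n \<rho> \<longleftrightarrow> set \<rho> \<subseteq> {1..<n} \<and> length \<rho> = perm_length n (word_act \<rho>)"

lemma reduced_words_iff: "\<rho> \<in> reduced_words n w \<longleftrightarrow> is_reduced n \<rho> \<and> word_act \<rho> = w"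
  by (auto simp: reduced_words_def is_reduced_def word_act_def)

lemma perm_length_id [simp]: "perm_length n id = 0"
proof -
  have "{(i, j). 1 \<le> i \<and> i < j \<and> j \<le> n \<and> id i > (id j :: nat)} = {}" by auto
  then show ?thesis unfolding perm_length_def by (simp only: card.empty)
qed

lemma perm_length_word_act_le: "set \<rho> \<subseteq> {1..<n} \<Longrightarrow> perm_length n (word_act \<rho>) \<le> length \<rho>"
proof (induction \<rho>)
  case (Cons k \<rho>)
  then have p: "word_act \<rho> permutes {1..n}" by (intro word_act_permutes) auto
  from permutes_less_or_greater[OF p, of k] show ?case
    using Cons perm_length_simple_act[of k n "word_act \<rho>"]
      perm_length_simple_act_descent[of k n "word_act \<rho>"] by auto
qed simp

lemma is_reduced_Nil [simp]: "is_reduced n []"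
  by (simp add: is_reduced_def)

text \<open>Every letter changes the length by exactly one and
  \<open>perm_length_word_act_le\<close> bounds it by the word length, so a word is reduced only if
  each letter acts at an ascent.\<close>

lemma is_reduced_Cons:
  "is_reduced n (k # \<rho>) \<longleftrightarrow>
     is_reduced n \<rho> \<and> k \<in> {1..<n} \<and> word_act \<rho> k < word_act \<rho> (Suc k)"
proof (cases "set (k # \<rho>) \<subseteq> {1..<n}")
  case True
  then have p: "word_act \<rho> permutes {1..n}" by (intro word_act_permutes) auto
  from permutes_less_or_greater[OF p, of k] show ?thesis
    using True perm_length_simple_act[of k n "word_act \<rho>"] perm_length_word_act_le[of \<rho> n]
      perm_length_simple_act_descent[of k n "word_act \<rho>"] by (auto simp: is_reduced_def)
qed (auto simp: is_reduced_def)

lemma is_reduced_permutes: "is_reduced n \<rho> \<Longrightarrow> word_act \<rho> permutes {1..n}"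
  by (simp add: is_reduced_def word_act_permutes)

lemma is_reduced_append: "is_reduced n (\<alpha> @ \<beta>) \<Longrightarrow> is_reduced n \<beta>"
  by (induction \<alpha>) (auto simp: is_reduced_Cons)

section \<open>Rothe diagrams and the tableau of exchange times\<close>

lemma rothe_iff:
  assumes p: "w permutes {1..n}"
  shows "(i, c) \<in> rothe n w \<longleftrightarrow> 1 \<le> i \<and> i < inv w c \<and> inv w c \<le> n \<and> c < w i"
proof -
  have "c = w j \<longleftrightarrow> j = inv w c" for j
    using permutes_inverses[OF p] by metis
  moreover have "w (inv w c) = c" using permutes_inverses[OF p] by simp
  ultimately show ?thesis unfolding rothe_def by auto
qed

lemma finite_rothe: "w permutes {1..n} \<Longrightarrow> finite (rothe n w)"
proof -
  have "rothe n w = (\<lambda>(i, j). (i, w j)) ` {(i, j). 1 \<le> i \<and> i < j \<and> j \<le> n \<and> w i > w j}"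
    by (auto simp: rothe_def)
  then show ?thesis using perm_length_finite by auto
qed

lemma rothe_bounds: "(i, c) \<in> rothe n w \<Longrightarrow> 1 \<le> i \<and> i < n"
  by (auto simp: rothe_def)

lemma rothe_value: "(i, w j) \<in> rothe n w \<longleftrightarrow> 1 \<le> i \<and> i < j \<and> j \<le> n \<and> w j < w i"
  if "inj w"
  using that by (auto simp: rothe_def inj_eq)

text \<open>Rows are positions and get swapped; columns are values and stay. The new inversion lies
  in row \<open>k\<close>, where the larger value now stands, and in the column of the smaller value
  \<open>u k\<close>.\<close>

lemma rothe_simple_act:
  assumes p: "u permutes {1..n}" and k: "k \<in> {1..<n}" and less: "u k < u (Suc k)"
  shows "(i, c) \<in> rothe n (simple_act k u) \<longleftrightarrow>
    i = k \<and> c = u k \<or> (transpose k (Suc k) i, c) \<in> rothe n u"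
proof -
  let ?s = "transpose k (Suc k)"
  have inj: "inj u" "inj (simple_act k u)"
    using permutes_inj[OF p] permutes_inj[OF simple_act_permutes[OF p k]] .
  obtain j where c: "c = u j" using permutes_surj[OF p] by (metis surjD)
  then have c': "c = simple_act k u (?s j)" by (simp add: simple_act_apply)
  have "(i, c) \<in> rothe n (simple_act k u) \<longleftrightarrow> 1 \<le> i \<and> i < ?s j \<and> ?s j \<le> n \<and> u j < u (?s i)"
    unfolding c' rothe_value[OF inj(2)] by (simp add: simple_act_apply)
  also have "\<dots> \<longleftrightarrow> i = k \<and> j = k \<or> (1 \<le> ?s i \<and> ?s i < j \<and> j \<le> n \<and> u j < u (?s i))"
    using k less by (auto simp: transpose_def)
  also have "\<dots> \<longleftrightarrow> i = k \<and> c = u k \<or> (?s i, c) \<in> rothe n u"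
    unfolding c rothe_value[OF inj(1)] using inj by (auto simp: inj_eq)
  finally show ?thesis .
qed

lemma rothe_id [simp]: "rothe n id = {}"
  by (auto simp: rothe_def)

lemma swap_rows_image:
  "(i, c) \<in> (\<lambda>(i, c). (transpose k (Suc k) i, c)) ` D \<longleftrightarrow> (transpose k (Suc k) i, c) \<in> D"
proof
  assume "(transpose k (Suc k) i, c) \<in> D"
  then have "(\<lambda>(i, c). (transpose k (Suc k) i, c)) (transpose k (Suc k) i, c) \<in>
      (\<lambda>(i, c). (transpose k (Suc k) i, c)) ` D"
    by (rule imageI)
  then show "(i, c) \<in> (\<lambda>(i, c). (transpose k (Suc k) i, c)) ` D" by simp
qed auto

lemma rothe_simple_act_insert:
  assumes "u permutes {1..n}" "k \<in> {1..<n}" "u k < u (Suc k)"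
  shows "rothe n (simple_act k u) =
    insert (k, u k) ((\<lambda>(i, c). (transpose k (Suc k) i, c)) ` rothe n u)"
  using rothe_simple_act[OF assms] by (auto simp: swap_rows_image simp del: image_iff)

text \<open>The head letter has the latest time, since positions count from the right; older cells
  are looked up with rows \<open>k\<close> and \<open>Suc k\<close> swapped back. The function is
  total, with dummy value 0, and is cut down to the diagram only in \<open>tableau\<close>, so that
  the recursion carries no domain.\<close>

fun word_tab :: "nat list \<Rightarrow> nat \<times> nat \<Rightarrow> nat" where
  "word_tab [] x = 0"
| "word_tab (k # \<rho>) (i, c) =
     (if i = k \<and> c = word_act \<rho> k then Suc (length \<rho>)
      else word_tab \<rho> (transpose k (Suc k) i, c))"

lemma word_tab_le: "word_tab \<rho> x \<le> length \<rho>"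
proof (induction \<rho> arbitrary: x)
  case (Cons k \<rho>)
  show ?case using Cons.IH by (cases x) (auto intro: le_SucI)
qed simp

lemma word_tab_less: "word_tab \<rho> x < Suc (length \<rho>)"
  using word_tab_le by (simp add: le_imp_less_Suc)

text \<open>Before the exchange \<open>u k\<close> stands to the left of position
  \<open>Suc k\<close>. Hence no old cell lands on the new cell \<open>(k, u k)\<close> when the
  rows are swapped.\<close>

lemma rothe_new_cell:
  assumes p: "u permutes {1..n}"
  shows "(Suc k, u k) \<notin> rothe n u"
  using rothe_value[OF permutes_inj[OF p]] by auto

lemma bij_betw_word_tab:
  "is_reduced n \<rho> \<Longrightarrow> bij_betw (word_tab \<rho>) (rothe n (word_act \<rho>)) {1..length \<rho>}"
proof (induction \<rho>)
  case (Cons k \<rho>)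
  let ?u = "word_act \<rho>" and ?s = "transpose k (Suc k)"
  have k: "k \<in> {1..<n}" "?u k < ?u (Suc k)" and red: "is_reduced n \<rho>"
    using Cons.prems by (auto simp: is_reduced_Cons)
  note p = is_reduced_permutes[OF red]
  let ?f = "\<lambda>(i, c). (?s i, c :: nat)"
  note D = rothe_simple_act_insert[OF p k]
  have new: "(k, ?u k) \<notin> ?f ` rothe n ?u"
    using rothe_new_cell[OF p, of k] by auto
  have "bij_betw (word_tab (k # \<rho>) \<circ> ?f) (rothe n ?u) {1..length \<rho>}"
  proof (rule iffD1[OF bij_betw_cong Cons.IH[OF red]])
    fix x assume "x \<in> rothe n ?u"
    then show "word_tab \<rho> x = (word_tab (k # \<rho>) \<circ> ?f) x"
      using rothe_new_cell[OF p, of k] by (cases x) auto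
  qed
  moreover have "bij_betw ?f (rothe n ?u) (?f ` rothe n ?u)"
    by (rule inj_on_imp_bij_betw) (auto simp: inj_on_def)
  ultimately have "bij_betw (word_tab (k # \<rho>)) (?f ` rothe n ?u) {1..length \<rho>}"
    by (simp add: bij_betw_comp_iff2 bij_betw_comp_iff[symmetric])
  then have "bij_betw (word_tab (k # \<rho>)) (insert (k, ?u k) (?f ` rothe n ?u))
      (insert (word_tab (k # \<rho>) (k, ?u k)) {1..length \<rho>})"
    by (subst notIn_Un_bij_betw3[where A = "?f ` rothe n ?u", simplified, symmetric])
      (use new in auto)
  also have "insert (word_tab (k # \<rho>) (k, ?u k)) {1..length \<rho>} = {1..length (k # \<rho>)}"
    by auto
  finally show ?case by (simp only: word_act_Cons D)
qed (simp add: bij_betw_def)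

text \<open>The values \<open>c < w i < w j\<close> start in this order and end as
  \<open>w i\<close>, \<open>w j\<close>, \<open>c\<close>. In a reduced word the two larger ones
  are never exchanged, so \<open>c\<close> passes \<open>w i\<close> before
  \<open>w j\<close>.\<close>

lemma word_tab_column_mono:
  assumes "is_reduced n \<rho>" "word_act \<rho> = w"
    and "(i, c) \<in> rothe n w" "(j, c) \<in> rothe n w" "i < j" "w i < w j"
  shows "word_tab \<rho> (i, c) < word_tab \<rho> (j, c)"
  using assms
proof (induction \<rho> arbitrary: w i j)
  case (Cons k \<rho>)
  let ?u = "word_act \<rho>" and ?s = "transpose k (Suc k)"
  have k: "k \<in> {1..<n}" "?u k < ?u (Suc k)" and red: "is_reduced n \<rho>"
    using Cons.prems by (auto simp: is_reduced_Cons)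
  note p = is_reduced_permutes[OF red]
  have w: "w = simple_act k ?u" using Cons.prems by simp
  \<comment> \<open>The newest cell of a column is its topmost one: \<open>c\<close> has just moved
    to position \<open>Suc k\<close>, so its column has no cell above row \<open>k\<close>.\<close>
  have i: "\<not> (i = k \<and> c = ?u k)"
  proof
    assume *: "i = k \<and> c = ?u k"
    then have "c = w (Suc k)" by (simp add: w simple_act_apply)
    then have "j < Suc k"
      using Cons.prems(4) rothe_value[OF permutes_inj[OF simple_act_permutes[OF p k(1)]]]
      unfolding w by auto
    then show False using * Cons.prems(5) by simp
  qed
  show ?case
  proof (cases "j = k \<and> c = ?u k")
    case True
    then show ?thesis using i word_tab_less[of \<rho>] by auto
  next
    case False
    have "\<not> (i = k \<and> j = Suc k)"
      using Cons.prems(6) k(2) by (auto simp: w simple_act_apply)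
    then have "?s i < ?s j" 
      using Cons.prems(5) transpose_Suc_less_iff[of i j k] by (auto simp: doubleton_eq_iff)
    moreover have "(?s i, c) \<in> rothe n ?u" "(?s j, c) \<in> rothe n ?u"
      using Cons.prems(3,4) i False rothe_simple_act[OF p k] unfolding w by auto
    moreover have "?u (?s i) < ?u (?s j)" using Cons.prems(6) by (simp add: w simple_act_apply)
    ultimately have "word_tab \<rho> (?s i, c) < word_tab \<rho> (?s j, c)"
      using Cons.IH[OF red refl] by blast
    then show ?thesis using i False by auto
  qed
qed simp

section \<open>Balanced tableaux and reduced words\<close>

definition right_count :: "(nat \<times> nat) set \<Rightarrow> (nat \<times> nat \<Rightarrow> nat) \<Rightarrow> nat \<Rightarrow> nat \<Rightarrow> nat" where
  "right_count D T r c = card {c'. (r, c') \<in> D \<and> c < c' \<and> T (r, c) < T (r, c')}"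

definition above_count :: "(nat \<times> nat) set \<Rightarrow> (nat \<times> nat \<Rightarrow> nat) \<Rightarrow> nat \<Rightarrow> nat \<Rightarrow> nat" where
  "above_count D T r c = card {r'. (r', c) \<in> D \<and> r < r' \<and> T (r', c) < T (r, c)}"

definition balanced :: "(nat \<times> nat) set \<Rightarrow> (nat \<times> nat \<Rightarrow> nat) \<Rightarrow> bool" where
  "balanced D T \<longleftrightarrow> (\<forall>r c. (r, c) \<in> D \<longrightarrow> right_count D T r c = above_count D T r c)"

lemma SBT_iff:
  "T \<in> SBT n w \<longleftrightarrow> T \<in> extensional (rothe n w) \<and>
     bij_betw T (rothe n w) {1..perm_length n w} \<and> balanced (rothe n w) T"
  by (auto simp: SBT_def balanced_def right_count_def above_count_def)

lemma balanced_cong: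
  assumes "\<And>x. x \<in> D \<Longrightarrow> T x = T' x"
  shows "balanced D T \<longleftrightarrow> balanced D T'"
proof -
  have "right_count D T r c = right_count D T' r c" "above_count D T r c = above_count D T' r c"
    if "(r, c) \<in> D" for r c
    unfolding right_count_def above_count_def using that assms
    by (auto intro!: arg_cong[where f = card])
  then show ?thesis unfolding balanced_def by auto
qed

text \<open>A value below \<open>u k\<close> to the right of position \<open>k\<close> cannot stand
  at \<open>Suc k\<close>, where \<open>u\<close> is larger, so it lies to the right of
  \<open>Suc k\<close> as well.\<close>

lemma rothe_row_Suc:
  assumes p: "u permutes {1..n}" and k: "k \<in> {1..<n}" and less: "u k < u (Suc k)"
  shows "(k, c) \<in> rothe n u \<longleftrightarrow> (Suc k, c) \<in> rothe n u \<and> c < u k"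
proof -
  have "inv u c \<noteq> Suc k" if "c < u k"
    using that less permutes_inverses(1)[OF p, of c] by auto
  then show ?thesis using k less unfolding rothe_iff[OF p] by auto
qed

lemma rothe_finite_row_col:
  assumes "w permutes {1..n}"
  shows "finite {c. (i, c) \<in> rothe n w \<and> P c}" "finite {i. (i, c) \<in> rothe n w \<and> Q i}"
proof -
  have "finite (rothe n w)" by (rule finite_rothe[OF assms])
  then have "finite (snd ` rothe n w)" "finite (fst ` rothe n w)" by auto
  moreover have "{c. (i, c) \<in> rothe n w \<and> P c} \<subseteq> snd ` rothe n w"
    "{i. (i, c) \<in> rothe n w \<and> Q i} \<subseteq> fst ` rothe n w" by force+
  ultimately show "finite {c. (i, c) \<in> rothe n w \<and> P c}" "finite {i. (i, c) \<in> rothe n w \<and> Q i}"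
    using finite_subset by blast+
qed

lemma card_Un_if:
  assumes "L = R \<union> (if P then {a} else {})" "finite R" "P \<Longrightarrow> a \<notin> R"
  shows "card L = card R + (if P then 1 else 0)"
  using assms by (cases P) auto

text \<open>The new entry \<open>l\<close> is maximal and never counted, and only rows
  \<open>k\<close> and \<open>Suc k\<close> change their relative height. A cell of row
  \<open>Suc k\<close> in a column \<open>c < u k\<close> moves below the former cell of row
  \<open>k\<close>, whose entry is smaller by the last hypothesis on \<open>T'\<close>, and gains
  one. The fillings are arbitrary so that the lemma serves both for building tableaux from words and
  for deleting from a given tableau.\<close>

lemma above_count_simple_act:
  assumes p: "u permutes {1..n}" and k: "k \<in> {1..<n}" and less: "u k < u (Suc k)"
    and l: "\<And>x. x \<in> rothe n u \<Longrightarrow> T' x < l"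
    and new: "T (k, u k) = l"
    and old: "\<And>i c. (i, c) \<in> rothe n u \<Longrightarrow> T (transpose k (Suc k) i, c) = T' (i, c)"
    and rows: "\<And>c. (k, c) \<in> rothe n u \<Longrightarrow> T' (k, c) < T' (Suc k, c)"
    and ic: "(i, c) \<in> rothe n u"
  shows "above_count (rothe n (simple_act k u)) T (transpose k (Suc k) i) c =
    above_count (rothe n u) T' i c + (if i = Suc k \<and> c < u k then 1 else 0)"
proof -
  let ?s = "transpose k (Suc k)"
  let ?D = "rothe n (simple_act k u)" and ?D' = "rothe n u"
  note D = rothe_simple_act[OF p k less]
  let ?L = "{j. (j, c) \<in> ?D \<and> ?s i < j \<and> T (j, c) < T (?s i, c)}"
  let ?R = "{j. (j, c) \<in> ?D' \<and> i < j \<and> T' (j, c) < T' (i, c)}"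
  have "?L = ?s ` {j. (j, c) \<in> ?D' \<and> ?s i < ?s j \<and> T' (j, c) < T' (i, c)}" (is "_ = ?s ` ?M")
  proof (intro equalityI subsetI)
    fix j assume *: "j \<in> ?L"
    then have "T (j, c) < l" using old[OF ic] l[OF ic] by simp
    then have "\<not> (j = k \<and> c = u k)" using new by auto
    then have "(?s j, c) \<in> ?D'" using * D[of j c] by auto
    then have "?s j \<in> ?M" using * old[OF ic] old[of "?s j" c] by simp
    then have "?s (?s j) \<in> ?s ` ?M" by (rule imageI)
    then show "j \<in> ?s ` ?M" by simp
  next
    fix j assume "j \<in> ?s ` ?M"
    then obtain j' where "j = ?s j'" "j' \<in> ?M" by auto
    then show "j \<in> ?L" using old[OF ic] old[of j' c] D[of j c] by simp
  qed
  then have "card ?L = card ?M" by (simp add: card_image inj_on_def)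
  moreover have "card ?M = card ?R + (if i = Suc k \<and> c < u k then 1 else 0)"
  proof (rule card_Un_if)
    show "?M = ?R \<union> (if i = Suc k \<and> c < u k then {k} else {})"
    proof (intro equalityI subsetI)
      fix j assume *: "j \<in> ?M"
      show "j \<in> ?R \<union> (if i = Suc k \<and> c < u k then {k} else {})"
      proof (cases "{i, j} = {k, Suc k}")
        case True
        then have "i = Suc k" "j = k" using * by (auto simp: doubleton_eq_iff)
        then show ?thesis using * rothe_row_Suc[OF p k less, of c] by simp
      next
        case False
        then show ?thesis using * transpose_Suc_less_iff[OF False] by simp
      qed
    next
      fix j assume *: "j \<in> ?R \<union> (if i = Suc k \<and> c < u k then {k} else {})"
      show "j \<in> ?M"
      proof (cases "j \<in> ?R")
        case True
        have "{i, j} \<noteq> {k, Suc k}" using True rows[of c] ic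
          by (auto simp: doubleton_eq_iff)
        then show ?thesis using True transpose_Suc_less_iff by blast
      next
        case False
        then have "i = Suc k" "c < u k" "j = k" using * by (auto split: if_splits)
        then show ?thesis using ic rows[of c] rothe_row_Suc[OF p k less, of c] by simp
      qed
    qed
    show "finite ?R" by (rule rothe_finite_row_col[OF p])
    show "k \<notin> ?R" if "i = Suc k \<and> c < u k" using that by auto
  qed
  ultimately show ?thesis unfolding above_count_def by (simp only:)
qed

lemma above_count_new_cell:
  assumes p: "u permutes {1..n}" and k: "k \<in> {1..<n}"
  shows "above_count (rothe n (simple_act k u)) T k (u k) = 0"
proof -
  have "simple_act k u (Suc k) = u k" by (simp add: simple_act_apply)
  then have "{i. (i, u k) \<in> rothe n (simple_act k u) \<and> k < i \<and> T (i, u k) < T (k, u k)} = {}"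
    using rothe_value[OF permutes_inj[OF simple_act_permutes[OF p k]], of _ "Suc k"] by auto
  then show ?thesis unfolding above_count_def by (simp only: card.empty)
qed

text \<open>Both counts grow at the same cells: a cell of row \<open>Suc k\<close> in a column
  \<open>c < u k\<close> gains the new maximal entry to its right and, by
  \<open>above_count_simple_act\<close>, a smaller entry above. At the new cell both counts are 0,
  as nothing exceeds it and it tops its column.\<close>

lemma balanced_simple_act:
  assumes p: "u permutes {1..n}" and k: "k \<in> {1..<n}" and less: "u k < u (Suc k)"
    and l: "\<And>x. x \<in> rothe n u \<Longrightarrow> T' x < l"
    and new: "T (k, u k) = l"
    and old: "\<And>i c. (i, c) \<in> rothe n u \<Longrightarrow> T (transpose k (Suc k) i, c) = T' (i, c)"
    and rows: "\<And>c. (k, c) \<in> rothe n u \<Longrightarrow> T' (k, c) < T' (Suc k, c)"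
  shows "balanced (rothe n (simple_act k u)) T \<longleftrightarrow> balanced (rothe n u) T'"
proof -
  let ?s = "transpose k (Suc k)"
  let ?D = "rothe n (simple_act k u)" and ?D' = "rothe n u"
  note D = rothe_simple_act[OF p k less]
  have T_le: "T x \<le> l" if "x \<in> ?D" for x
  proof (cases x)
    case (Pair i c)
    then show ?thesis
      using that D[of i c] new old[of "?s i" c] l[of "(?s i, c)"] by auto
  qed
  have right: "right_count ?D T (?s i) c =
      right_count ?D' T' i c + (if i = Suc k \<and> c < u k then 1 else 0)"
    if ic: "(i, c) \<in> ?D'" for i c
  proof -
    let ?L = "{c'. (?s i, c') \<in> ?D \<and> c < c' \<and> T (?s i, c) < T (?s i, c')}"
    let ?R = "{c'. (i, c') \<in> ?D' \<and> c < c' \<and> T' (i, c) < T' (i, c')}"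
    have "card ?L = card ?R + (if i = Suc k \<and> c < u k then 1 else 0)"
    proof (rule card_Un_if)
      show "?L = ?R \<union> (if i = Suc k \<and> c < u k then {u k} else {})"
      proof (intro equalityI subsetI)
        fix c' assume *: "c' \<in> ?L"
        show "c' \<in> ?R \<union> (if i = Suc k \<and> c < u k then {u k} else {})"
        proof (cases "?s i = k \<and> c' = u k")
          case True
          then have "i = Suc k" by simp
          then show ?thesis using * True by auto
        next
          case False
          then have "(i, c') \<in> ?D'" using * D[of "?s i" c'] by auto
          then show ?thesis using * old[OF ic] old[of i c'] by auto
        qed
      next
        fix c' assume *: "c' \<in> ?R \<union> (if i = Suc k \<and> c < u k then {u k} else {})"
        show "c' \<in> ?L"
        proof (cases "c' \<in> ?R")
          case True
          then show ?thesis using old[OF ic] old[of i c'] D[of "?s i" c'] by simp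
        next
          case False
          then have "i = Suc k" "c < u k" "c' = u k" using * by (auto split: if_splits)
          then show ?thesis using old[OF ic] l[OF ic] new D[of k "u k"] by simp
        qed
      qed
      show "finite ?R" by (rule rothe_finite_row_col[OF p])
      show "u k \<notin> ?R" if "i = Suc k \<and> c < u k" using that rothe_new_cell[OF p, of k] by auto
    qed
    then show ?thesis unfolding right_count_def .
  qed
  note above = above_count_simple_act[of u n k T' l T, OF p k less l new old rows]
  have "right_count ?D T k (u k) = 0"
  proof -
    have "{c'. (k, c') \<in> ?D \<and> u k < c' \<and> T (k, u k) < T (k, c')} = {}"
      using T_le new by (auto simp: not_less)
    then show ?thesis unfolding right_count_def by (simp only: card.empty)
  qed
  moreover note above_count_new_cell[OF p k, of T]
  ultimately have "balanced ?D T \<longleftrightarrow>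
      (\<forall>i c. (?s i, c) \<in> ?D' \<longrightarrow> right_count ?D T i c = above_count ?D T i c)"
    unfolding balanced_def D by auto
  also have "\<dots> \<longleftrightarrow> (\<forall>i c. (i, c) \<in> ?D' \<longrightarrow> right_count ?D T (?s i) c = above_count ?D T (?s i) c)"
    by (metis transpose_involutory)
  also have "\<dots> \<longleftrightarrow> balanced ?D' T'"
    unfolding balanced_def using right above by auto
  finally show ?thesis .
qed

text \<open>Supplies the row hypothesis of \<open>balanced_simple_act\<close> for words: at an
  ascent, rows \<open>k\<close> and \<open>Suc k\<close> are an instance of
  \<open>word_tab_column_mono\<close>.\<close>

lemma word_tab_rows_less:
  assumes "is_reduced n (k # \<rho>)" "(k, c) \<in> rothe n (word_act \<rho>)"
  shows "word_tab \<rho> (k, c) < word_tab \<rho> (Suc k, c)"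
proof -
  have k: "k \<in> {1..<n}" "word_act \<rho> k < word_act \<rho> (Suc k)" and red: "is_reduced n \<rho>"
    using assms(1) by (auto simp: is_reduced_Cons)
  show ?thesis
    using word_tab_column_mono[OF red refl assms(2)] k
      rothe_row_Suc[OF is_reduced_permutes[OF red] k, of c] assms(2) by auto
qed

lemma word_tab_old:
  assumes "is_reduced n (k # \<rho>)" "(i, c) \<in> rothe n (word_act \<rho>)"
  shows "word_tab (k # \<rho>) (transpose k (Suc k) i, c) = word_tab \<rho> (i, c)"
  using assms rothe_new_cell[OF is_reduced_permutes, of n \<rho> k]
  by (auto simp: is_reduced_Cons)

lemma balanced_word_tab: "is_reduced n \<rho> \<Longrightarrow> balanced (rothe n (word_act \<rho>)) (word_tab \<rho>)"
proof (induction \<rho>)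
  case (Cons k \<rho>)
  have k: "k \<in> {1..<n}" "word_act \<rho> k < word_act \<rho> (Suc k)" and red: "is_reduced n \<rho>"
    using Cons.prems by (auto simp: is_reduced_Cons)
  show ?case
    unfolding word_act_Cons
    using Cons.IH[OF red] word_tab_less[of \<rho>] word_tab_old[OF Cons.prems]
      word_tab_rows_less[OF Cons.prems]
    by (subst balanced_simple_act[OF is_reduced_permutes[OF red] k,
          where T' = "word_tab \<rho>" and l = "Suc (length \<rho>)"]) auto
qed (simp add: balanced_def)

definition tableau :: "nat \<Rightarrow> nat list \<Rightarrow> nat \<times> nat \<Rightarrow> nat" where
  "tableau n \<rho> = restrict (word_tab \<rho>) (rothe n (word_act \<rho>))"

lemma tableau_in_SBT:
  assumes "\<rho> \<in> reduced_words n w"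
  shows "tableau n \<rho> \<in> SBT n w"
proof -
  have red: "is_reduced n \<rho>" and w: "word_act \<rho> = w"
    using assms by (auto simp: reduced_words_iff)
  have l: "perm_length n w = length \<rho>" using red w by (simp add: is_reduced_def)
  show ?thesis
    unfolding SBT_iff l
    using bij_betw_word_tab[OF red] balanced_word_tab[OF red]
      balanced_cong[of "rothe n w" "tableau n \<rho>" "word_tab \<rho>"]
      bij_betw_cong[of "rothe n w" "tableau n \<rho>" "word_tab \<rho>"]
    by (auto simp: tableau_def w)
qed

text \<open>Nothing exceeds the maximal entry, so by balance its cell tops its column, and all
  values strictly between position \<open>k\<close> and the position \<open>j\<close> of
  \<open>c\<close> are below \<open>c\<close>. If there were any, the largest of them,
  \<open>m\<close>, would give a cell \<open>(k, m)\<close> that also tops its column but has the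
  maximal entry to its right, against balance.\<close>

lemma SBT_max_cell:
  assumes p: "w permutes {1..n}" and T: "T \<in> SBT n w"
    and cell: "(k, c) \<in> rothe n w" and max: "T (k, c) = perm_length n w"
  shows "c = w (Suc k)"
proof -
  let ?D = "rothe n w"
  have bij: "bij_betw T ?D {1..perm_length n w}" and bal: "balanced ?D T"
    using T by (auto simp: SBT_iff)
  have le: "T x \<le> perm_length n w" if "x \<in> ?D" for x
    using bij that by (auto simp: bij_betw_def)
  have inj: "inj_on T ?D" using bij by (simp add: bij_betw_def)
  obtain j where j: "k < j" "j \<le> n" "c = w j" "w j < w k" "1 \<le> k"
    using cell by (auto simp: rothe_def)
  have injw: "inj w" using permutes_inj[OF p] .
  have "{c'. (k, c') \<in> ?D \<and> c < c' \<and> T (k, c) < T (k, c')} = {}"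
    using le max by (auto simp: not_less)
  then have "right_count ?D T k c = 0" unfolding right_count_def by (simp only: card.empty)
  then have "above_count ?D T k c = 0" using bal cell by (auto simp: balanced_def)
  then have top: "\<not> ((i, c) \<in> ?D \<and> k < i \<and> T (i, c) < T (k, c))" for i
    using rothe_finite_row_col(2)[OF p] by (auto simp: above_count_def)
  have between: "w i < c" if "k < i" "i < j" for i
  proof (rule ccontr)
    assume "\<not> w i < c"
    moreover have "w i \<noteq> c" using that j injw by (auto simp: inj_eq)
    ultimately have "(i, c) \<in> ?D" using that j rothe_value[OF injw] by auto
    moreover then have "T (i, c) \<noteq> T (k, c)" using inj_onD[OF inj _ _ cell] that by auto
    ultimately show False using top[of i] le[of "(i, c)"] max that by auto
  qed
  show ?thesis
  proof (rule ccontr)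
    assume "c \<noteq> w (Suc k)"
    then have "Suc k < j" using j by (metis Suc_lessI)
    then have ne: "w ` {Suc k..<j} \<noteq> {}" by auto
    define m where "m = Max (w ` {Suc k..<j})"
    have "m \<in> w ` {Suc k..<j}" unfolding m_def using ne by (intro Max_in) auto
    then obtain i where i: "m = w i" "k < i" "i < j" by auto
    have m_max: "w i' \<le> m" if "k < i'" "i' < j" for i'
      unfolding m_def using that by (intro Max_ge) auto
    have mc: "m < c" using between i by auto
    have cell': "(k, m) \<in> ?D" using i j mc rothe_value[OF injw] by auto
    have "{i'. (i', m) \<in> ?D \<and> k < i' \<and> T (i', m) < T (k, m)} = {}"
    proof -
      have "False" if "(i', m) \<in> ?D" "k < i'" for i'
        using that m_max[of i'] i rothe_value[OF injw, of i' i] by auto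
      then show ?thesis by auto
    qed
    then have "above_count ?D T k m = 0" unfolding above_count_def by (simp only: card.empty)
    then have "right_count ?D T k m = 0" using bal cell' by (auto simp: balanced_def)
    then have "\<not> ((k, c) \<in> ?D \<and> m < c \<and> T (k, m) < T (k, c))"
      using rothe_finite_row_col(1)[OF p] by (auto simp: right_count_def)
    moreover have "T (k, m) \<noteq> T (k, c)" using inj_onD[OF inj _ cell' cell] mc by auto
    ultimately show False using cell mc le[OF cell'] max by auto
  qed
qed

text \<open>Take the rightmost column \<open>y\<close> that violates the claim. To its right row
  \<open>k\<close> dominates row \<open>Suc k\<close>, so each entry counted for
  \<open>(Suc k, y)\<close> has a counterpart for \<open>(k, y)\<close>, and the maximal entry is
  counted in row \<open>k\<close> only: the right count is strictly larger in row \<open>k\<close>.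
  The count above is at most as large there, since \<open>T (k, y) < T (Suc k, y)\<close>. This
  contradicts balance.\<close>

lemma SBT_max_rows:
  assumes p: "w permutes {1..n}" and T: "T \<in> SBT n w"
    and cell: "(k, w (Suc k)) \<in> rothe n w" and max: "T (k, w (Suc k)) = perm_length n w"
    and y: "(Suc k, y) \<in> rothe n w"
  shows "T (Suc k, y) < T (k, y)"
proof (rule ccontr)
  let ?D = "rothe n w"
  assume "\<not> T (Suc k, y) < T (k, y)"
  have bij: "bij_betw T ?D {1..perm_length n w}" and bal: "balanced ?D T"
    using T by (auto simp: SBT_iff)
  have le: "T x \<le> perm_length n w" if "x \<in> ?D" for x
    using bij that by (auto simp: bij_betw_def)
  have inj: "inj_on T ?D" using bij by (simp add: bij_betw_def)
  have row: "(k, y) \<in> ?D" "y < w (Suc k)" if "(Suc k, y) \<in> ?D" for y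
    using cell that unfolding rothe_iff[OF p] by auto
  define Y where "Y = {y. (Suc k, y) \<in> ?D \<and> \<not> T (Suc k, y) < T (k, y)}"
  have "finite Y" unfolding Y_def by (rule rothe_finite_row_col[OF p])
  moreover have "Y \<noteq> {}" using y \<open>\<not> T (Suc k, y) < T (k, y)\<close> by (auto simp: Y_def)
  ultimately have MY: "Max Y \<in> Y" "\<And>z. z \<in> Y \<Longrightarrow> z \<le> Max Y" by auto
  define y where "y = Max Y"
  have y: "(Suc k, y) \<in> ?D" "\<not> T (Suc k, y) < T (k, y)"
    using MY by (auto simp: Y_def y_def)
  have y': "T (Suc k, z) < T (k, z)" if "(Suc k, z) \<in> ?D" "y < z" for z
    using MY(2)[of z] that by (fastforce simp: Y_def y_def)
  have lt: "T (k, y) < T (Suc k, y)"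
    using y inj_onD[OF inj, of "(Suc k, y)" "(k, y)"] row(1)[OF y(1)] by force
  let ?R = "\<lambda>i. {c'. (i, c') \<in> ?D \<and> y < c' \<and> T (i, y) < T (i, c')}"
  let ?A = "\<lambda>i. {r'. (r', y) \<in> ?D \<and> i < r' \<and> T (r', y) < T (i, y)}"
  have fin: "finite (?R i)" "finite (?A i)" for i
    by (rule rothe_finite_row_col[OF p])+
  have "insert (w (Suc k)) (?R (Suc k)) \<subseteq> ?R k"
  proof
    fix c' assume "c' \<in> insert (w (Suc k)) (?R (Suc k))"
    then show "c' \<in> ?R k"
    proof
      assume "c' = w (Suc k)"
      then show ?thesis using cell row[OF y(1)] le[OF y(1)] max lt by auto
    next
      assume "c' \<in> ?R (Suc k)"
      then show ?thesis using y'[of c'] row[of c'] lt by auto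
    qed
  qed
  then have "card (insert (w (Suc k)) (?R (Suc k))) \<le> card (?R k)"
    using fin by (intro card_mono) auto
  moreover have "w (Suc k) \<notin> ?R (Suc k)" using row(2) by blast
  ultimately have "card (?R (Suc k)) < card (?R k)" using fin by simp
  moreover have "?A k \<subseteq> ?A (Suc k)"
  proof
    fix r assume "r \<in> ?A k"
    then show "r \<in> ?A (Suc k)" using lt by (cases "r = Suc k") auto
  qed
  then have "card (?A k) \<le> card (?A (Suc k))" using fin by (intro card_mono) auto
  moreover have "card (?R (Suc k)) = card (?A (Suc k))" "card (?R k) = card (?A k)"
    using bal y(1) row(1)[OF y(1)]
    by (auto simp: balanced_def right_count_def above_count_def)
  ultimately show False by simp
qed

text \<open>The row of the maximal entry is the head letter of the word sought; the rest of the word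
  comes from the tableau with that entry deleted.\<close>

lemma tableau_surj:
  assumes "w permutes {1..n}" "T \<in> SBT n w"
  shows "\<exists>\<rho> \<in> reduced_words n w. tableau n \<rho> = T"
  using assms
proof (induction "perm_length n w" arbitrary: w T)
  case 0
  then have bij: "bij_betw T (rothe n w) {}" by (simp add: SBT_iff)
  then have D: "rothe n w = {}" by (simp add: bij_betw_def)
  have "w = id"
  proof (rule ccontr)
    assume "w \<noteq> id"
    then obtain k where "k \<in> {1..<n}" "w k > w (Suc k)"
      using exists_descent[OF "0.prems"(1)] by blast
    then have "(k, w (Suc k)) \<in> rothe n w" by (auto simp: rothe_def)
    then show False using D by simp
  qed
  then have "[] \<in> reduced_words n w" by (simp add: reduced_words_iff)
  moreover have "tableau n [] = T"
  proof
    fix x show "tableau n [] x = T x"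
      using "0.prems"(2) D by (cases x) (simp add: SBT_iff tableau_def extensional_def)
  qed
  ultimately show ?case by blast
next
  case (Suc l)
  note p = Suc.prems(1)
  have bij: "bij_betw T (rothe n w) {1..Suc l}" and bal: "balanced (rothe n w) T"
    and ext: "T \<in> extensional (rothe n w)"
    using Suc.prems Suc.hyps(2) by (auto simp: SBT_iff)
  have "Suc l \<in> T ` rothe n w" using bij by (simp add: bij_betw_def)
  then obtain k c where kc: "(k, c) \<in> rothe n w" "T (k, c) = perm_length n w"
    using Suc.hyps(2) by auto
  have c: "c = w (Suc k)" by (rule SBT_max_cell[OF p Suc.prems(2) kc])
  have k: "k \<in> {1..<n}" using rothe_bounds[OF kc(1)] by auto
  define u where "u = simple_act k w"
  have w: "w = simple_act k u" by (simp add: u_def)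
  have pu: "u permutes {1..n}" unfolding u_def by (rule simple_act_permutes[OF p k])
  have uk: "u k = w (Suc k)" "u (Suc k) = w k" by (simp_all add: u_def simple_act_apply)
  have less: "u k < u (Suc k)"
    using kc(1) rothe_iff[OF p, of k c] c by (simp add: uk)
  have l: "l = perm_length n u"
    using Suc.hyps(2) perm_length_simple_act[OF k less] w by simp
  let ?s = "transpose k (Suc k)"
  note D = rothe_simple_act[OF pu k less, folded w]
  define T' where "T' = restrict (\<lambda>(i, c). T (?s i, c)) (rothe n u)"
  have inj: "inj_on T (rothe n w)" using bij by (simp add: bij_betw_def)
  have new: "(k, u k) \<notin> (\<lambda>(i, c). (?s i, c)) ` rothe n u"
    using rothe_new_cell[OF pu, of k] by auto
  have img: "(\<lambda>(i, c). (?s i, c)) ` rothe n u = rothe n w - {(k, u k)}"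
    using rothe_simple_act_insert[OF pu k less, folded w] new by (metis Diff_insert_absorb)
  have "bij_betw (\<lambda>(i, c). (?s i, c)) (rothe n u) (rothe n w - {(k, u k)})"
    by (rule bij_betw_imageI[OF _ img]) (auto simp: inj_on_def)
  moreover have "bij_betw T (rothe n w - {(k, u k)}) {1..l}"
  proof -
    have "T ` (rothe n w - {(k, u k)}) = T ` rothe n w - {Suc l}"
      using inj_on_image_set_diff[OF inj, of "rothe n w" "{(k, u k)}"] kc c uk Suc.hyps(2) by auto
    also have "\<dots> = {1..l}" using bij by (auto simp: bij_betw_def)
    finally show ?thesis using inj by (auto simp: bij_betw_def intro: inj_on_diff)
  qed
  ultimately have "bij_betw (T \<circ> (\<lambda>(i, c). (?s i, c))) (rothe n u) {1..l}"
    by (rule bij_betw_trans)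
  then have bij': "bij_betw T' (rothe n u) {1..l}"
    by (rule iffD1[OF bij_betw_cong, rotated]) (auto simp: T'_def)
  \<comment> \<open>Applied in the deleting direction, opposite to \<open>balanced_word_tab\<close>;
    the row hypothesis comes from \<open>SBT_max_rows\<close>, with the two rows swapped
    back.\<close>
  have "balanced (rothe n (simple_act k u)) T \<longleftrightarrow> balanced (rothe n u) T'"
  proof (rule balanced_simple_act[OF pu k less])
    show "T' x < Suc l" if "x \<in> rothe n u" for x
      using bij_betw_apply[OF bij' that] by simp
    show "T (k, u k) = Suc l" using kc c uk Suc.hyps(2) by simp
    show "T (?s i, c) = T' (i, c)" if "(i, c) \<in> rothe n u" for i c
      using that by (simp add: T'_def)
    show "T' (k, y) < T' (Suc k, y)" if "(k, y) \<in> rothe n u" for y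
    proof -
      have "(Suc k, y) \<in> rothe n u" using that rothe_row_Suc[OF pu k less] by blast
      moreover have "T (Suc k, y) < T (k, y)"
        using SBT_max_rows[OF p Suc.prems(2) kc[unfolded c]] D[of "Suc k" y] that by simp
      ultimately show ?thesis using that by (simp add: T'_def)
    qed
  qed
  then have "T' \<in> SBT n u"
    unfolding SBT_iff using bal bij' by (auto simp: w[symmetric] T'_def l[symmetric])
  then obtain \<rho> where \<rho>: "\<rho> \<in> reduced_words n u" "tableau n \<rho> = T'"
    using Suc.hyps(1)[OF l pu] by blast
  have red: "is_reduced n (k # \<rho>)" and actu: "word_act \<rho> = u"
    using \<rho>(1) k less by (auto simp: reduced_words_iff is_reduced_Cons)
  have "k # \<rho> \<in> reduced_words n w" using red actu w by (simp add: reduced_words_iff)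
  moreover have "tableau n (k # \<rho>) = T"
  proof (rule extensionalityI[OF _ ext])
    show "tableau n (k # \<rho>) \<in> extensional (rothe n w)"
      using actu w by (simp add: tableau_def)
    fix x assume x: "x \<in> rothe n w"
    obtain i c' where ic: "x = (i, c')" by (cases x)
    have lenr: "length \<rho> = l" using \<rho>(1) l by (simp add: reduced_words_def)
    show "tableau n (k # \<rho>) x = T x"
    proof (cases "i = k \<and> c' = u k")
      case True
      then show ?thesis
        using x ic kc c uk Suc.hyps(2) actu w lenr by (simp add: tableau_def)
    next
      case False
      then have "(?s i, c') \<in> rothe n u" using x ic D[of i c'] by blast
      then have "word_tab \<rho> (?s i, c') = T (i, c')"
        using \<rho>(2) actu by (auto simp: tableau_def T'_def fun_eq_iff restrict_def split: if_splits)
      then show ?thesis using False x ic actu w by (auto simp: tableau_def)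
    qed
  qed
  ultimately show ?case by blast
qed

section \<open>Coxeter moves\<close>

lemma word_act_append_cong:
  "word_act \<gamma> = word_act \<gamma>' \<Longrightarrow> word_act (\<alpha> @ \<gamma>) = word_act (\<alpha> @ \<gamma>')"
  by (induction \<alpha>) auto

text \<open>The letters of \<open>\<alpha>\<close> act at times later than \<open>p\<close> and
  \<open>q\<close>, so the transposition fixes their entries; as both suffixes give the same
  permutation, these entries lie in the same cells.\<close>

lemma word_tab_append_transpose:
  assumes act: "word_act \<gamma>' = word_act \<gamma>" and len: "length \<gamma>' = length \<gamma>"
    and "p \<le> length \<gamma>" "q \<le> length \<gamma>"
    and tab: "\<And>x. word_tab \<gamma>' x = transpose p q (word_tab \<gamma> x)"
  shows "word_tab (\<alpha> @ \<gamma>') x = transpose p q (word_tab (\<alpha> @ \<gamma>) x)"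
proof (induction \<alpha> arbitrary: x)
  case (Cons k \<alpha>)
  have "word_act (\<alpha> @ \<gamma>') = word_act (\<alpha> @ \<gamma>)"
    by (rule word_act_append_cong[OF act])
  then show ?case using Cons assms by (cases x) auto
qed (simp add: tab)

lemma commute_act:
  assumes "\<bar>int x - int y\<bar> > 1"
  shows "word_act (y # x # \<beta>) = word_act (x # y # \<beta>)"
proof
  fix i show "word_act (y # x # \<beta>) i = word_act (x # y # \<beta>) i"
    using assms by (auto simp: simple_act_apply transpose_def)
qed

lemma commute_tab:
  assumes "\<bar>int x - int y\<bar> > 1"
  shows "word_tab (y # x # \<beta>) c =
    transpose (Suc (length \<beta>)) (Suc (Suc (length \<beta>))) (word_tab (x # y # \<beta>) c)"
proof -
  have "transpose (Suc (length \<beta>)) (Suc (Suc (length \<beta>))) (word_tab \<beta> z) = word_tab \<beta> z" for z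
    using word_tab_le[of \<beta> z] by (intro transpose_apply_other) auto
  moreover have neq: "x \<noteq> y" "x \<noteq> Suc y" "Suc x \<noteq> y" using assms by auto
  moreover have "transpose y (Suc y) (transpose x (Suc x) i) =
      transpose x (Suc x) (transpose y (Suc y) i)" for i
    using neq by (auto simp: transpose_def)
  moreover have "transpose x (Suc x) i = y \<longleftrightarrow> i = y" "transpose y (Suc y) i = x \<longleftrightarrow> i = x" for i
    using neq by (auto simp: transpose_def)
  ultimately show ?thesis by (cases c) (auto simp: simple_act_apply)
qed

lemma braid_act: "word_act (a # Suc a # a # \<beta>) = word_act (Suc a # a # Suc a # \<beta>)"
proof
  fix i show "word_act (a # Suc a # a # \<beta>) i = word_act (Suc a # a # Suc a # \<beta>) i"
    by (auto simp: simple_act_apply transpose_def)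
qed

lemma inj_word_act: "inj (word_act \<rho>)"
  by (induction \<rho>) (auto simp: simple_act_apply inj_on_def dest: transpose_eq_imp_eq)

text \<open>Both words exchange the same three values pairwise, in opposite orders. The middle
  exchange is in both cases that of the smallest and the largest value when the words are reduced,
  so its time stays and the outer two times are swapped.\<close>

lemma braid_tab:
  "word_tab (a # Suc a # a # \<beta>) c = transpose (Suc (length \<beta>)) (Suc (Suc (Suc (length \<beta>))))
     (word_tab (Suc a # a # Suc a # \<beta>) c)"
proof -
  let ?s = "transpose a (Suc a)" and ?t = "transpose (Suc a) (Suc (Suc a))"
  let ?r = "transpose (Suc (length \<beta>)) (Suc (Suc (Suc (length \<beta>))))"
  obtain i y where c: "c = (i, y)" by (cases c)
  have old: "?r (word_tab \<beta> z) = word_tab \<beta> z" for z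
    using word_tab_le[of \<beta> z] by (intro transpose_apply_other) auto
  have braid: "?s (?t (?s i)) = ?t (?s (?t i))" by (auto simp: transpose_def)
  have eqs: "?s i = Suc a \<longleftrightarrow> i = a" "?t (?s i) = a \<longleftrightarrow> i = Suc a"
    "?t i = a \<longleftrightarrow> i = a" "?s (?t i) = Suc a \<longleftrightarrow> i = a"
    by (auto simp: transpose_def)
  have neq: "word_act \<beta> a \<noteq> word_act \<beta> (Suc a)"
    using inj_word_act[of \<beta>] by (simp add: inj_eq)
  have "word_tab (a # Suc a # a # \<beta>) c =
     (if i = a \<and> y = word_act \<beta> (Suc a) then Suc (Suc (Suc (length \<beta>)))
      else if i = a \<and> y = word_act \<beta> a then Suc (Suc (length \<beta>))
      else if i = Suc a \<and> y = word_act \<beta> a then Suc (length \<beta>)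
      else word_tab \<beta> (?s (?t (?s i)), y))"
    using eqs neq by (auto simp: c simple_act_apply)
  moreover have "word_tab (Suc a # a # Suc a # \<beta>) c =
     (if i = a \<and> y = word_act \<beta> (Suc a) then Suc (length \<beta>)
      else if i = a \<and> y = word_act \<beta> a then Suc (Suc (length \<beta>))
      else if i = Suc a \<and> y = word_act \<beta> a then Suc (Suc (Suc (length \<beta>)))
      else word_tab \<beta> (?t (?s (?t i)), y))"
    using eqs neq by (auto simp: c simple_act_apply)
  ultimately show ?thesis using old braid neq by auto
qed

lemma braid_tab_sym:
  "word_tab (Suc a # a # Suc a # \<beta>) c = transpose (Suc (length \<beta>)) (Suc (Suc (Suc (length \<beta>))))
     (word_tab (a # Suc a # a # \<beta>) c)"
  unfolding braid_tab by (rule transpose_involutory[symmetric])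

lemma letter_append [simp]: "letter (\<alpha> @ x # \<beta>) (Suc (length \<beta>)) = x"
  by (simp add: letter_def)

lemma letter_append2 [simp]: "letter (\<alpha> @ x # y # \<beta>) (Suc (length \<beta>)) = y"
  using letter_append[of "\<alpha> @ [x]" y \<beta>] by simp

lemma letter_append3 [simp]: "letter (\<alpha> @ x # y # z # \<beta>) (Suc (length \<beta>)) = z"
  using letter_append[of "\<alpha> @ [x, y]" z \<beta>] by simp

lemma set_letter_append [simp]: "set_letter (Suc (length \<beta>)) a (\<alpha> @ x # \<beta>) = \<alpha> @ a # \<beta>"
  by (simp add: set_letter_def)

lemma set_letter_append2 [simp]:
  "set_letter (Suc (length \<beta>)) a (\<alpha> @ x # y # \<beta>) = \<alpha> @ x # a # \<beta>"
  using set_letter_append[of \<beta> a "\<alpha> @ [x]" y] by simp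

lemma set_letter_append3 [simp]:
  "set_letter (Suc (length \<beta>)) a (\<alpha> @ x # y # z # \<beta>) = \<alpha> @ x # y # a # \<beta>"
  using set_letter_append[of \<beta> a "\<alpha> @ [x, y]" z] by simp

lemma word_c_append:
  "word_c (Suc (length \<beta>)) (\<alpha> @ x # y # \<beta>) =
     (if \<bar>int x - int y\<bar> > 1 then \<alpha> @ y # x # \<beta> else \<alpha> @ x # y # \<beta>)"
  using letter_append[of \<alpha> x "y # \<beta>"] set_letter_append[of "y # \<beta>" y \<alpha> x]
  by (auto simp: word_c_def)

lemma word_b_append:
  "word_b (Suc (Suc (length \<beta>))) (\<alpha> @ x # y # z # \<beta>) =
     (if x = z \<and> \<bar>int x - int y\<bar> = 1 then \<alpha> @ y # x # y # \<beta> else \<alpha> @ x # y # z # \<beta>)"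
  using letter_append[of \<alpha> x "y # z # \<beta>"] letter_append2[of \<alpha> x y "z # \<beta>"]
    set_letter_append[of "x # y # \<beta>" y \<alpha> x] set_letter_append2[of "y # \<beta>" x \<alpha> x y]
  by (auto simp: word_b_def)

text \<open>The letter \<open>x\<close> exchanges the values \<open>v x\<close> and
  \<open>v (Suc x)\<close> present at its time. The column is the smaller value and the row is the
  final position of the larger one, whence \<open>inv w\<close>. This lets the geometric conditions
  of the tableau moves be read off the letters.\<close>

lemma word_tab_cell:
  assumes "is_reduced n (\<alpha> @ x # \<beta>)"
  defines "w \<equiv> word_act (\<alpha> @ x # \<beta>)" and "v \<equiv> word_act \<beta>"
  shows "(inv w (v (Suc x)), v x) \<in> rothe n w \<and>
    word_tab (\<alpha> @ x # \<beta>) (inv w (v (Suc x)), v x) = Suc (length \<beta>)"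
  using assms(1) unfolding w_def v_def
proof (induction \<alpha>)
  case Nil
  then have x: "x \<in> {1..<n}" "word_act \<beta> x < word_act \<beta> (Suc x)" and red: "is_reduced n \<beta>"
    by (auto simp: is_reduced_Cons)
  note p = is_reduced_permutes[OF red]
  have "inv (simple_act x (word_act \<beta>)) (word_act \<beta> (Suc x)) = x"
    by (rule inv_f_eq[OF permutes_inj[OF simple_act_permutes[OF p x(1)]]])
      (simp add: simple_act_apply)
  then show ?case using rothe_simple_act[OF p x] by simp
next
  case (Cons k \<alpha>)
  let ?\<rho> = "\<alpha> @ x # \<beta>"
  have k: "k \<in> {1..<n}" "word_act ?\<rho> k < word_act ?\<rho> (Suc k)" and red: "is_reduced n ?\<rho>"
    using Cons.prems by (auto simp: is_reduced_Cons)
  note p = is_reduced_permutes[OF red]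
  note pw = simple_act_permutes[OF p k(1)]
  have inv: "inv (simple_act k (word_act ?\<rho>)) b = transpose k (Suc k) (inv (word_act ?\<rho>) b)" for b
    by (rule inv_f_eq[OF permutes_inj[OF pw]])
      (simp add: simple_act_apply permutes_inverses[OF p])
  note IH = Cons.IH[OF red]
  then show ?case
    using word_tab_old[of n k ?\<rho>] Cons.prems rothe_simple_act[OF p k]
    by (simp add: inv)
qed

lemma tableau_cell:
  assumes "is_reduced n (\<alpha> @ x # \<beta>)"
  defines "w \<equiv> word_act (\<alpha> @ x # \<beta>)" and "v \<equiv> word_act \<beta>"
  shows "the_inv_into (rothe n w) (tableau n (\<alpha> @ x # \<beta>)) (Suc (length \<beta>)) =
    (inv w (v (Suc x)), v x)"
proof (rule the_inv_into_f_eq)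
  show "inj_on (tableau n (\<alpha> @ x # \<beta>)) (rothe n w)"
    using bij_betw_word_tab[OF assms(1)]
    by (auto simp: tableau_def w_def bij_betw_def inj_on_def)
  show "(inv w (v (Suc x)), v x) \<in> rothe n w"
    using word_tab_cell[OF assms(1)] by (simp add: w_def v_def)
  then show "tableau n (\<alpha> @ x # \<beta>) (inv w (v (Suc x)), v x) = Suc (length \<beta>)"
    using word_tab_cell[OF assms(1)] by (simp add: tableau_def w_def v_def)
qed

lemma tableau_exchange:
  assumes "word_act \<gamma>' = word_act \<gamma>" "length \<gamma>' = length \<gamma>"
    and "p \<le> length \<gamma>" "q \<le> length \<gamma>"
    and "\<And>x. word_tab \<gamma>' x = transpose p q (word_tab \<gamma> x)"
  shows "tableau n (\<alpha> @ \<gamma>') =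
    exchange (rothe n (word_act (\<alpha> @ \<gamma>))) p q (tableau n (\<alpha> @ \<gamma>))"
  using word_tab_append_transpose[OF assms, of \<alpha>]
    word_act_append_cong[OF assms(1), of \<alpha>]
  unfolding tableau_def exchange_def restrict_def by auto

lemma inv_permutes_eq_iff:
  "w permutes S \<Longrightarrow> inv w a = inv w b \<longleftrightarrow> a = b"
  by (metis permutes_inverses(1))

text \<open>If \<open>x = Suc y\<close>, the two exchanges share their smaller value, hence a
  column; if \<open>y = Suc x\<close>, they share the larger one, hence a row; \<open>x = y\<close>
  cannot occur in a reduced word. So both moves act under the same condition.\<close>

lemma tableau_word_c_append:
  assumes red: "is_reduced n (\<alpha> @ x # y # \<beta>)" (is "is_reduced n ?\<rho>")
  defines "i \<equiv> Suc (length \<beta>)"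
  shows "tableau n (word_c i ?\<rho>) = tab_c (rothe n (word_act ?\<rho>)) i (tableau n ?\<rho>)"
proof -
  let ?w = "word_act ?\<rho>" and ?v = "word_act \<beta>"
  have red2: "is_reduced n (x # y # \<beta>)" using is_reduced_append[OF red] .
  then have rb: "is_reduced n \<beta>" and less: "?v y < ?v (Suc y)"
    "?v (transpose y (Suc y) x) < ?v (transpose y (Suc y) (Suc x))"
    by (auto simp: is_reduced_Cons simple_act_apply)
  have inj: "inj ?v" using permutes_inj[OF is_reduced_permutes[OF rb]] .
  have neq: "x \<noteq> y" using less by auto
  note pw = is_reduced_permutes[OF red]
  have Y: "the_inv_into (rothe n ?w) (tableau n ?\<rho>) i = (inv ?w (?v (Suc y)), ?v y)"
    using tableau_cell[of n "\<alpha> @ [x]" y \<beta>] red by (simp add: i_def)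
  have X: "the_inv_into (rothe n ?w) (tableau n ?\<rho>) (i + 1) =
      (inv ?w (?v (transpose y (Suc y) (Suc x))), ?v (transpose y (Suc y) x))"
    using tableau_cell[of n \<alpha> x "y # \<beta>"] red
    by (simp add: i_def simple_act_apply)
  have cond: "\<bar>int x - int y\<bar> > 1 \<longleftrightarrow>
      ?v (Suc y) \<noteq> ?v (transpose y (Suc y) (Suc x)) \<and> ?v y \<noteq> ?v (transpose y (Suc y) x)"
    using neq inj_eq[OF inj] by auto
  show ?thesis
  proof (cases "\<bar>int x - int y\<bar> > 1")
    case True
    have "tableau n (\<alpha> @ y # x # \<beta>) =
        exchange (rothe n ?w) (Suc (length \<beta>)) (Suc (Suc (length \<beta>))) (tableau n ?\<rho>)"
      by (rule tableau_exchange[OF commute_act[OF True] _ _ _ commute_tab[OF True]]) simp_all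
    then have "tableau n (\<alpha> @ y # x # \<beta>) = exchange (rothe n ?w) i (i + 1) (tableau n ?\<rho>)"
      by (simp add: i_def)
    then show ?thesis
      using True cond unfolding tab_c_def Let_def X Y
      by (simp add: i_def word_c_append inv_permutes_eq_iff[OF pw])
  next
    case False
    then show ?thesis
      using cond unfolding tab_c_def Let_def X Y
      by (auto simp: i_def word_c_append inv_permutes_eq_iff[OF pw])
  qed
qed

text \<open>In a braid pattern the middle exchange involves the smallest and the largest of three
  values, so its cell shares its column with one temporal neighbour and its row with the
  other.\<close>

lemma tableau_word_b_append:
  assumes red: "is_reduced n (\<alpha> @ x # y # z # \<beta>)" (is "is_reduced n ?\<rho>")
  defines "i \<equiv> Suc (Suc (length \<beta>))"
  shows "tableau n (word_b i ?\<rho>) = tab_b (rothe n (word_act ?\<rho>)) i (tableau n ?\<rho>)"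
proof -
  let ?w = "word_act ?\<rho>" and ?v = "word_act \<beta>"
  let ?sz = "transpose z (Suc z)" and ?sy = "transpose y (Suc y)"
  have red2: "is_reduced n (x # y # z # \<beta>)" using is_reduced_append[OF red] .
  then have rb: "is_reduced n \<beta>" and less: "?v z < ?v (Suc z)"
    "?v (?sz y) < ?v (?sz (Suc y))" "?v (?sz (?sy x)) < ?v (?sz (?sy (Suc x)))"
    by (auto simp: is_reduced_Cons simple_act_apply)
  have inj: "inj ?v" using permutes_inj[OF is_reduced_permutes[OF rb]] .
  note pw = is_reduced_permutes[OF red]
  let ?Z = "(inv ?w (?v (Suc z)), ?v z)"
  let ?Y = "(inv ?w (?v (?sz (Suc y))), ?v (?sz y))"
  let ?X = "(inv ?w (?v (?sz (?sy (Suc x)))), ?v (?sz (?sy x)))"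
  have Z: "the_inv_into (rothe n ?w) (tableau n ?\<rho>) (i - 1) = ?Z"
    using tableau_cell[of n "\<alpha> @ [x, y]" z \<beta>] red by (simp add: i_def)
  have Y: "the_inv_into (rothe n ?w) (tableau n ?\<rho>) i = ?Y"
    using tableau_cell[of n "\<alpha> @ [x]" y "z # \<beta>"] red by (simp add: i_def simple_act_apply)
  have X: "the_inv_into (rothe n ?w) (tableau n ?\<rho>) (i + 1) = ?X"
    using tableau_cell[of n \<alpha> x "y # z # \<beta>"] red
    by (simp add: i_def simple_act_apply)
  have ZD: "?Z \<in> rothe n ?w" and XD: "?X \<in> rothe n ?w"
    using word_tab_cell[of n "\<alpha> @ [x, y]" z \<beta>] word_tab_cell[of n \<alpha> x "y # z # \<beta>"] red
    by (simp_all add: simple_act_apply)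
  \<comment> \<open>A cell records that the larger value \<open>b\<close> ends to the left of
    \<open>a\<close>; this decides which of the two cells in the common column is the upper
    one.\<close>
  have inverted: "inv ?w b < inv ?w a" if "(inv ?w b, a) \<in> rothe n ?w" for a b
    using that unfolding rothe_iff[OF pw] by simp
  have cond: "above ?Z ?Y \<and> right_of ?X ?Y \<or> above ?X ?Y \<and> right_of ?Z ?Y \<longleftrightarrow>
      x = z \<and> \<bar>int x - int y\<bar> = 1"
  proof
    assume "above ?Z ?Y \<and> right_of ?X ?Y \<or> above ?X ?Y \<and> right_of ?Z ?Y"
    then show "x = z \<and> \<bar>int x - int y\<bar> = 1"
      by (auto simp: above_def right_of_def inj_eq[OF inj] inv_permutes_eq_iff[OF pw])
  next
    assume "x = z \<and> \<bar>int x - int y\<bar> = 1"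
    then consider "x = z" "y = Suc z" | "x = z" "z = Suc y" by linarith
    then show "above ?Z ?Y \<and> right_of ?X ?Y \<or> above ?X ?Y \<and> right_of ?Z ?Y"
    proof cases
      case 1
      then show ?thesis using inverted[of "?v (Suc (Suc z))" "?v (Suc z)"] XD less
        by (simp add: above_def right_of_def)
    next
      case 2
      then show ?thesis using inverted[of "?v (Suc (Suc y))" "?v (Suc y)"] ZD less
        by (simp add: above_def right_of_def)
    qed
  qed
  show ?thesis
  proof (cases "x = z \<and> \<bar>int x - int y\<bar> = 1")
    case True
    then consider "x = z" "y = Suc z" | "x = z" "z = Suc y" by linarith
    then have "tableau n (\<alpha> @ y # x # y # \<beta>) = exchange (rothe n ?w)
        (Suc (length \<beta>)) (Suc (Suc (Suc (length \<beta>)))) (tableau n ?\<rho>)"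
    proof cases
      case 1
      show ?thesis unfolding 1
        by (rule tableau_exchange[OF braid_act[symmetric] _ _ _ braid_tab_sym]) simp_all
    next
      case 2
      show ?thesis unfolding 2
        by (rule tableau_exchange[OF braid_act _ _ _ braid_tab]) simp_all
    qed
    then have "tableau n (\<alpha> @ y # x # y # \<beta>) =
        exchange (rothe n ?w) (i - 1) (i + 1) (tableau n ?\<rho>)"
      by (simp add: i_def)
    then show ?thesis
      using True cond unfolding tab_b_def Let_def X Y Z
      by (simp add: i_def word_b_append)
  next
    case False
    then show ?thesis
      using cond unfolding tab_b_def Let_def X Y Z
      by (auto simp: i_def word_b_append)
  qed
qed

lemma split_word2:
  assumes "1 \<le> i" "i < length \<rho>"
  obtains \<alpha> x y \<beta> where "\<rho> = \<alpha> @ x # y # \<beta>" "i = Suc (length \<beta>)"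
proof
  let ?j = "length \<rho> - Suc i"
  show "\<rho> = take ?j \<rho> @ \<rho> ! ?j # \<rho> ! Suc ?j # drop (Suc (Suc ?j)) \<rho>"
    using assms by (simp add: Cons_nth_drop_Suc)
  show "i = Suc (length (drop (Suc (Suc ?j)) \<rho>))" using assms by simp
qed

lemma split_word3:
  assumes "1 < i" "i < length \<rho>"
  obtains \<alpha> x y z \<beta> where "\<rho> = \<alpha> @ x # y # z # \<beta>" "i = Suc (Suc (length \<beta>))"
proof
  let ?j = "length \<rho> - Suc i"
  show "\<rho> = take ?j \<rho> @ \<rho> ! ?j # \<rho> ! Suc ?j # \<rho> ! Suc (Suc ?j) # drop (Suc (Suc (Suc ?j))) \<rho>"
    using assms by (simp add: Cons_nth_drop_Suc)
  show "i = Suc (Suc (length (drop (Suc (Suc (Suc ?j))) \<rho>)))" using assms by simp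
qed

lemma word_c_reduced:
  assumes "\<rho> \<in> reduced_words n w" "1 \<le> i" "i < length \<rho>"
  shows "word_c i \<rho> \<in> reduced_words n w"
    and "tableau n (word_c i \<rho>) = tab_c (rothe n w) i (tableau n \<rho>)"
proof -
  obtain \<alpha> x y \<beta> where \<rho>: "\<rho> = \<alpha> @ x # y # \<beta>" "i = Suc (length \<beta>)"
    using split_word2 assms(2,3) by blast
  have *: "is_reduced n \<rho>" "word_act \<rho> = w" using assms(1) by (auto simp: reduced_words_iff)
  then show "tableau n (word_c i \<rho>) = tab_c (rothe n w) i (tableau n \<rho>)"
    using tableau_word_c_append unfolding \<rho> by blast
  show "word_c i \<rho> \<in> reduced_words n w"
    using * word_act_append_cong[OF commute_act[of x y \<beta>], of \<alpha>]
    unfolding \<rho> word_c_append by (auto simp: reduced_words_iff is_reduced_def)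
qed

lemma word_b_reduced:
  assumes "\<rho> \<in> reduced_words n w" "1 < i" "i < length \<rho>"
  shows "word_b i \<rho> \<in> reduced_words n w"
    and "tableau n (word_b i \<rho>) = tab_b (rothe n w) i (tableau n \<rho>)"
proof -
  obtain \<alpha> x y z \<beta> where \<rho>: "\<rho> = \<alpha> @ x # y # z # \<beta>" "i = Suc (Suc (length \<beta>))"
    using split_word3 assms(2,3) by blast
  have *: "is_reduced n \<rho>" "word_act \<rho> = w" using assms(1) by (auto simp: reduced_words_iff)
  then show "tableau n (word_b i \<rho>) = tab_b (rothe n w) i (tableau n \<rho>)"
    using tableau_word_b_append unfolding \<rho> by blast
  show "word_b i \<rho> \<in> reduced_words n w"
  proof (cases "x = z \<and> \<bar>int x - int y\<bar> = 1")
    case True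
    then consider "x = z" "y = Suc z" | "x = z" "z = Suc y" by linarith
    then have "word_act (y # x # y # \<beta>) = word_act (x # y # z # \<beta>)"
      using braid_act[of z \<beta>] braid_act[of y \<beta>] by cases auto
    from word_act_append_cong[OF this, of \<alpha>] show ?thesis
      using * True unfolding \<rho> word_b_append by (auto simp: reduced_words_iff is_reduced_def)
  next
    case False
    then show ?thesis using * unfolding \<rho> word_b_append by (auto simp: reduced_words_iff)
  qed
qed

section \<open>The super-Yamanouchi word\<close>

text \<open>
  \<open>sy_tail r p \<rho>\<close> says that \<open>[r..<Suc p] @ \<rho>\<close> is super-Yamanouchi, where \<open>r \<le> p\<close>.
\<close>

fun sy_tail :: "nat \<Rightarrow> nat \<Rightarrow> nat list \<Rightarrow> bool" where
  "sy_tail r p [] \<longleftrightarrow> True"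
| "sy_tail r p (k # \<rho>) \<longleftrightarrow> (k = Suc p \<and> sy_tail r k \<rho>) \<or> (k < r \<and> sy_tail k k \<rho>)"

lemma runs_Cons: "\<exists>x rs. runs (p # \<rho>) = (p # x) # rs"
  by (cases \<rho>) auto

definition run_min :: "nat list \<Rightarrow> nat" where
  "run_min x = Min (set x)"

lemma run_min_consecutive:
  "successively (\<lambda>a b. b = Suc a) (k # x) \<Longrightarrow> run_min (k # x) = k"
  unfolding run_min_def
proof (induction x arbitrary: k)
  case (Cons a x)
  then have "a = Suc k" "Min (set (a # x)) = a" using Cons.IH[of a] by auto
  moreover have "Min (set (k # a # x)) = min k (Min (set (a # x)))"
    using Min_insert[of "set (a # x)" k] by simp
  ultimately show ?case by simp
qed simp

text \<open>The first run of \<open>p # \<rho>\<close> continues a run begun at \<open>r\<close>.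
  Its own minimum is therefore ignored, and the later runs are measured against
  \<open>r\<close>.\<close>

lemma sy_tail_iff:
  "r \<le> p \<Longrightarrow> sy_tail r p \<rho> \<longleftrightarrow>
     (\<forall>x \<in> set (runs (p # \<rho>)). successively (\<lambda>a b. b = Suc a) x) \<and>
     sorted_wrt (>) (map run_min (tl (runs (p # \<rho>)))) \<and>
     (\<forall>x \<in> set (tl (runs (p # \<rho>))). run_min x < r)"
proof (induction \<rho> arbitrary: r p)
  case (Cons k \<rho>)
  obtain h t where runs: "runs (k # \<rho>) = (k # h) # t" using runs_Cons by blast
  show ?case
  proof (cases "p < k")
    case True
    then have "\<not> k < r" "r \<le> k" using Cons.prems by auto
    then have "sy_tail r p (k # \<rho>) \<longleftrightarrow> k = Suc p \<and> sy_tail r k \<rho>" by auto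
    then show ?thesis
      unfolding Cons.IH[OF \<open>r \<le> k\<close>] using True runs by auto
  next
    case False
    then have "sy_tail r p (k # \<rho>) \<longleftrightarrow> k < r \<and> sy_tail k k \<rho>" by auto
    then show ?thesis
      unfolding Cons.IH[OF order_refl] using False runs run_min_consecutive[of k h]
      by (auto dest: less_trans)
  qed
qed simp

lemma super_yamanouchi_Nil: "super_yamanouchi []"
  by (simp add: super_yamanouchi_def)

lemma super_yamanouchi_Cons: "super_yamanouchi (k # \<rho>) \<longleftrightarrow> sy_tail k k \<rho>"
proof -
  obtain h t where "runs (k # \<rho>) = (k # h) # t" using runs_Cons by blast
  then show ?thesis
    unfolding super_yamanouchi_def sy_tail_iff[OF order_refl] run_min_def[symmetric]
    using run_min_consecutive[of k h] by auto
qed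

lemma sy_tail_mono: "sy_tail r p \<rho> \<Longrightarrow> r \<le> r' \<Longrightarrow> sy_tail r' p \<rho>"
  by (induction \<rho> arbitrary: r r' p) auto

lemma super_yamanouchi_tail: "super_yamanouchi (k # \<rho>) \<Longrightarrow> super_yamanouchi \<rho>"
  by (cases \<rho>) (auto simp: super_yamanouchi_Nil super_yamanouchi_Cons intro: sy_tail_mono)

text \<open>The adjacent transposition maps the indices other than \<open>k\<close> onto those other
  than \<open>Suc k\<close> and preserves their order, so the exempt position moves along with
  it.\<close>

lemma strict_mono_on_simple_act:
  assumes k: "r \<le> k" "k < n"
  shows "strict_mono_on ({r..n} - {k}) (simple_act k u) \<longleftrightarrow> strict_mono_on ({r..n} - {Suc k}) u"
proof -
  let ?s = "transpose k (Suc k)"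
  have mem: "?s i \<in> {r..n} - {Suc k} \<longleftrightarrow> i \<in> {r..n} - {k}" for i
    using k by (auto simp: transpose_def)
  have mono: "?s i < ?s j \<longleftrightarrow> i < j" if "i \<noteq> k" "j \<noteq> k" for i j
    using that transpose_Suc_less_iff[of i j k] by (auto simp: doubleton_eq_iff)
  have mono': "?s i < ?s j \<longleftrightarrow> i < j" if "i \<noteq> Suc k" "j \<noteq> Suc k" for i j
    using that transpose_Suc_less_iff[of i j k] by (auto simp: doubleton_eq_iff)
  have mem': "?s i \<in> {r..n} - {k} \<longleftrightarrow> i \<in> {r..n} - {Suc k}" for i
    using mem[of "?s i"] by simp
  show ?thesis
  proof
    assume L: "strict_mono_on ({r..n} - {k}) (simple_act k u)"
    show "strict_mono_on ({r..n} - {Suc k}) u"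
    proof (rule strict_mono_onI)
      fix i j assume "i \<in> {r..n} - {Suc k}" "j \<in> {r..n} - {Suc k}" "i < j"
      then have "?s i \<in> {r..n} - {k}" "?s j \<in> {r..n} - {k}" "?s i < ?s j"
        using mem' mono' by blast+
      then have "simple_act k u (?s i) < simple_act k u (?s j)" by (rule strict_mono_onD[OF L])
      then show "u i < u j" by (simp add: simple_act_apply)
    qed
  next
    assume R: "strict_mono_on ({r..n} - {Suc k}) u"
    show "strict_mono_on ({r..n} - {k}) (simple_act k u)"
    proof (rule strict_mono_onI)
      fix i j assume "i \<in> {r..n} - {k}" "j \<in> {r..n} - {k}" "i < j"
      then have "?s i \<in> {r..n} - {Suc k}" "?s j \<in> {r..n} - {Suc k}" "?s i < ?s j"
        using mem mono by blast+
      then have "u (?s i) < u (?s j)" by (rule strict_mono_onD[OF R])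
      then show "simple_act k u i < simple_act k u j" by (simp add: simple_act_apply)
    qed
  qed
qed

definition last_descent :: "nat \<Rightarrow> (nat \<Rightarrow> nat) \<Rightarrow> nat \<Rightarrow> bool" where
  "last_descent n w k \<longleftrightarrow> k \<in> {1..<n} \<and> w (Suc k) < w k \<and> strict_mono_on {Suc k..n} w"

lemma last_descent_unique:
  assumes "last_descent n w k" "last_descent n w k'"
  shows "k = k'"
proof -
  have "\<not> k < k'" if "last_descent n w k" "last_descent n w k'" for k k'
    using that strict_mono_onD[of "{Suc k..n}" w k' "Suc k'"] by (auto simp: last_descent_def)
  from this[OF assms] this[OF assms(2,1)] show ?thesis by simp
qed

lemma strict_mono_on_interval:
  fixes w :: "nat \<Rightarrow> nat"
  assumes "\<And>i. a \<le> i \<Longrightarrow> i < n \<Longrightarrow> w i < w (Suc i)"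
  shows "strict_mono_on {a..n} w"
proof (rule strict_mono_onI)
  fix i j assume "i \<in> {a..n}" "j \<in> {a..n}" "i < j"
  then have "Suc i \<le> j" "j \<le> n" "a \<le> i" by auto
  then show "w i < w j"
  proof (induction j rule: dec_induct)
    case (step j)
    then have "w i < w j" "w j < w (Suc j)" using assms[of j] by auto
    then show ?case by simp
  qed (use assms in auto)
qed

lemma exists_last_descent:
  assumes p: "w permutes {1..n}" and "w \<noteq> id"
  obtains k where "last_descent n w k"
proof -
  define S where "S = {k \<in> {1..<n}. w (Suc k) < w k}"
  have S: "finite S" "S \<noteq> {}" using exists_descent[OF assms] by (auto simp: S_def)
  then have "Max S \<in> S" by (rule Max_in)
  moreover have "strict_mono_on {Suc (Max S)..n} w"
  proof (rule strict_mono_on_interval)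
    fix i assume i: "Suc (Max S) \<le> i" "i < n"
    then have "i \<notin> S" using Max_ge[OF S(1), of i] by auto
    then show "w i < w (Suc i)" using i permutes_less_or_greater[OF p, of i] by (auto simp: S_def)
  qed
  ultimately show ?thesis using that by (auto simp: last_descent_def S_def)
qed

text \<open>Stripping the letters \<open>r\<close>, ..., \<open>p\<close> of the current run carries
  the value from position \<open>r\<close> to position \<open>Suc p\<close>; from \<open>r\<close>
  on, it is the only value that may break the increase.\<close>

lemma strict_mono_on_sy_tail:
  assumes "is_reduced n \<rho>" "sy_tail r p \<rho>" "r \<le> p"
  shows "strict_mono_on ({r..n} - {Suc p}) (word_act \<rho>)"
  using assms
proof (induction \<rho> arbitrary: r p)
  case Nil
  then show ?case by (simp add: strict_mono_on_def)
next
  case (Cons k \<rho>)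
  have k: "k \<in> {1..<n}" and red: "is_reduced n \<rho>"
    using Cons.prems by (auto simp: is_reduced_Cons)
  from Cons.prems(2) consider "k = Suc p" "sy_tail r k \<rho>" | "k < r" "sy_tail k k \<rho>" by auto
  then show ?case
  proof cases
    case 1
    then show ?thesis
      using Cons.IH[OF red 1(2)] Cons.prems(3) strict_mono_on_simple_act[of r k n] k by auto
  next
    case 2
    then have "strict_mono_on ({k..n} - {k}) (word_act (k # \<rho>))"
      using Cons.IH[OF red 2(2)] strict_mono_on_simple_act[of k k n] k by auto
    then show ?thesis by (rule monotone_on_subset) (use 2 in auto)
  qed
qed

lemma super_yamanouchi_last_descent:
  assumes "k # \<rho> \<in> reduced_words n w" "super_yamanouchi (k # \<rho>)"
  shows "last_descent n w k"
proof -
  have red: "is_reduced n (k # \<rho>)" and w: "w = simple_act k (word_act \<rho>)"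
    using assms by (auto simp: reduced_words_iff)
  then have *: "is_reduced n \<rho>" "k \<in> {1..<n}" "word_act \<rho> k < word_act \<rho> (Suc k)"
    by (auto simp: is_reduced_Cons)
  have "strict_mono_on ({k..n} - {k}) w"
    using strict_mono_on_sy_tail[OF *(1), of k k] assms(2) strict_mono_on_simple_act[of k k n] *(2)
    by (auto simp: super_yamanouchi_Cons w)
  moreover have "{k..n} - {k} = {Suc k..n}" by auto
  ultimately show ?thesis using * by (simp add: last_descent_def w simple_act_apply)
qed

text \<open>A descent at or beyond \<open>r\<close> must involve the exempt position
  \<open>Suc p\<close>, and \<open>p\<close> is an ascent. So the last descent is either
  \<open>Suc p\<close>, which prolongs the current run, or below \<open>r\<close>, which starts a
  new one.\<close>

lemma exists_sy_tail:
  assumes "w permutes {1..n}" "strict_mono_on ({r..n} - {Suc p}) w" "w p < w (Suc p)" "r \<le> p"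
  shows "\<exists>\<rho> \<in> reduced_words n w. sy_tail r p \<rho>"
  using assms
proof (induction "perm_length n w" arbitrary: w r p rule: less_induct)
  case less
  note p = less.prems(1)
  show ?case
  proof (cases "w = id")
    case True
    then have "[] \<in> reduced_words n w" by (simp add: reduced_words_iff)
    then show ?thesis by (intro bexI[of _ "[]"]) auto
  next
    case False
    then obtain k where last: "last_descent n w k" using exists_last_descent[OF p] by blast
    then have k: "k \<in> {1..<n}" "w (Suc k) < w k" and mono: "strict_mono_on {Suc k..n} w"
      by (auto simp: last_descent_def)
    let ?u = "simple_act k w"
    have u: "?u permutes {1..n}" "perm_length n ?u < perm_length n w" "?u k < ?u (Suc k)"
      using simple_act_permutes[OF p k(1)] perm_length_simple_act_descent[OF k] k
      by (auto simp: simple_act_apply)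
    have red: "k # \<rho> \<in> reduced_words n w" if "\<rho> \<in> reduced_words n ?u" for \<rho>
      using that k u by (auto simp: reduced_words_iff is_reduced_Cons)
    show ?thesis
    proof (cases "k < r")
      case True
      have "{Suc k..n} = {k..n} - {k}" by auto
      then have "strict_mono_on ({k..n} - {Suc k}) ?u"
        using mono strict_mono_on_simple_act[of k k n ?u] k by auto
      then obtain \<rho> where "\<rho> \<in> reduced_words n ?u" "sy_tail k k \<rho>"
        using less.hyps[OF u(2,1)] u(3) by blast
      then show ?thesis using red True by (intro bexI[of _ "k # \<rho>"]) auto
    next
      case False
      have "k = Suc p"
      proof (rule ccontr)
        assume "k \<noteq> Suc p"
        moreover have "k \<noteq> p" using k less.prems(3) by auto
        ultimately have "w k < w (Suc k)"
          using False k by (intro strict_mono_onD[OF less.prems(2)]) auto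
        then show False using k by simp
      qed
      then have "strict_mono_on ({r..n} - {Suc k}) ?u"
        using less.prems(2) False k strict_mono_on_simple_act[of r k n ?u] by auto
      then obtain \<rho> where "\<rho> \<in> reduced_words n ?u" "sy_tail r k \<rho>"
        using less.hyps[OF u(2,1)] u(3) False by (metis not_less)
      then show ?thesis using red \<open>k = Suc p\<close> by (intro bexI[of _ "k # \<rho>"]) auto
    qed
  qed
qed

lemma reduced_words_Cons:
  "k # \<rho> \<in> reduced_words n w \<Longrightarrow> \<rho> \<in> reduced_words n (simple_act k w)"
  by (auto simp: reduced_words_iff is_reduced_Cons)

lemma super_yamanouchi_unique:
  assumes "\<pi> \<in> reduced_words n w" "super_yamanouchi \<pi>"
    and "\<pi>' \<in> reduced_words n w" "super_yamanouchi \<pi>'"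
  shows "\<pi> = \<pi>'"
  using assms
proof (induction \<pi> arbitrary: \<pi>' w)
  case Nil
  then have "length \<pi>' = length ([] :: nat list)" unfolding reduced_words_def by (simp del: length_0_conv)
  then show ?case by simp
next
  case (Cons k \<pi>)
  then have "length \<pi>' \<noteq> 0" by (auto simp: reduced_words_def)
  then obtain k' \<pi>'' where \<pi>': "\<pi>' = k' # \<pi>''" by (cases \<pi>') auto
  have "k = k'"
    using last_descent_unique super_yamanouchi_last_descent Cons.prems unfolding \<pi>' by blast
  then show ?case
    using Cons.IH[OF reduced_words_Cons _ reduced_words_Cons] Cons.prems super_yamanouchi_tail
    unfolding \<pi>' by blast
qed

lemma sy_word_eq:
  assumes "\<pi> \<in> reduced_words n w" "super_yamanouchi \<pi>"
  shows "sy_word n w = \<pi>"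
  unfolding sy_word_def using assms super_yamanouchi_unique by blast

lemma sy_word_id: "sy_word n id = []"
  by (rule sy_word_eq) (simp_all add: reduced_words_iff super_yamanouchi_Nil)

lemma sy_word_Cons:
  assumes p: "w permutes {1..n}" and last: "last_descent n w k"
  shows "sy_word n w = k # sy_word n (simple_act k w)"
proof -
  let ?u = "simple_act k w"
  have k: "k \<in> {1..<n}" "w (Suc k) < w k" "strict_mono_on {Suc k..n} w"
    using last by (auto simp: last_descent_def)
  have u: "?u permutes {1..n}" "?u k < ?u (Suc k)"
    using simple_act_permutes[OF p k(1)] k by (auto simp: simple_act_apply)
  have "{Suc k..n} = {k..n} - {k}" by auto
  then have "strict_mono_on ({k..n} - {Suc k}) ?u"
    using k strict_mono_on_simple_act[of k k n ?u] by auto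
  then obtain \<rho> where \<rho>: "\<rho> \<in> reduced_words n ?u" "sy_tail k k \<rho>"
    using exists_sy_tail[OF u(1), of k k] u(2) by blast
  then have "k # \<rho> \<in> reduced_words n w"
    using k u by (auto simp: reduced_words_iff is_reduced_Cons)
  moreover have SY: "super_yamanouchi (k # \<rho>)" using \<rho> by (simp add: super_yamanouchi_Cons)
  ultimately show ?thesis
    using sy_word_eq[OF \<rho>(1) super_yamanouchi_tail[OF SY]] sy_word_eq by blast
qed

section \<open>The pairing algorithm\<close>

lemma sy_word_reduced:
  assumes "w permutes {1..n}"
  shows "sy_word n w \<in> reduced_words n w"
  using assms
proof (induction "perm_length n w" arbitrary: w rule: less_induct)
  case less
  note p = less.prems
  show ?case
  proof (cases "w = id")
    case True
    have "[] \<in> reduced_words n id" by (simp add: reduced_words_iff)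
    then show ?thesis unfolding True sy_word_id .
  next
    case False
    then obtain k where last: "last_descent n w k" using exists_last_descent[OF p] by blast
    then have k: "k \<in> {1..<n}" "w (Suc k) < w k" by (auto simp: last_descent_def)
    have "sy_word n (simple_act k w) \<in> reduced_words n (simple_act k w)"
      using less.hyps[OF _ simple_act_permutes[OF p k(1)]] perm_length_simple_act_descent[OF k] by auto
    then show ?thesis
      unfolding sy_word_Cons[OF p last] using k
      by (auto simp: reduced_words_iff is_reduced_Cons simple_act_apply)
  qed
qed

text \<open>
  Deleting letters from a word must not renumber the others, so letters carry their times as tags.
  The row contents of the tableau are computed without its columns because a deletion permutes
  entries within rows.
\<close>

fun tagged :: "nat list \<Rightarrow> (nat \<times> nat) list" where
  "tagged [] = []"
| "tagged (x # \<rho>) = (Suc (length \<rho>), x) # tagged \<rho>"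

fun row_entries :: "(nat \<times> nat) list \<Rightarrow> nat \<Rightarrow> nat set" where
  "row_entries [] i = {}"
| "row_entries ((t, k) # \<sigma>) i =
     (if i = k then {t} else {}) \<union> row_entries \<sigma> (transpose k (Suc k) i)"

text \<open>A letter equal to \<open>k\<close> stops the scan, so the transposition only ever lowers
  \<open>k\<close> from \<open>Suc x\<close> to \<open>x\<close>, as in \<open>scan\<close>. Written
  this way, the scan follows the same row index as \<open>row_entries\<close>.\<close>

fun scan_list :: "nat \<Rightarrow> (nat \<times> nat) list \<Rightarrow> nat" where
  "scan_list k [] = 0"
| "scan_list k ((t, x) # \<sigma>) = (if x = k then t else scan_list (transpose x (Suc x) k) \<sigma>)"

lemma map_snd_tagged [simp]: "map snd (tagged \<rho>) = \<rho>"
  by (induction \<rho>) auto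

lemma fst_tagged: "fst ` set (tagged \<rho>) = {1..length \<rho>}"
  by (induction \<rho>) (auto simp: atLeastAtMostSuc_conv)

lemma sorted_tagged: "sorted_wrt (>) (map fst (tagged \<rho>))"
proof (induction \<rho>)
  case (Cons x \<rho>)
  have "t \<le> length \<rho>" if "t \<in> fst ` set (tagged \<rho>)" for t
    using that unfolding fst_tagged by simp
  then show ?case using Cons by (auto simp: le_imp_less_Suc)
qed simp

lemma row_entries_subset: "row_entries \<sigma> i \<subseteq> fst ` set \<sigma>"
proof (induction \<sigma> arbitrary: i)
  case (Cons a \<sigma>)
  obtain t k where a: "a = (t, k)" by (cases a)
  have "row_entries \<sigma> (transpose k (Suc k) i) \<subseteq> fst ` set \<sigma>" by (rule Cons.IH)
  then show ?case by (auto simp: a)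
qed simp

lemma finite_row_entries: "finite (row_entries \<sigma> i)"
  using row_entries_subset by (rule finite_subset) simp

text \<open>Emptiness depends on the letters alone, so a list with gaps in its tags can be compared
  with the tableau of its own letters.\<close>

lemma row_entries_empty_iff:
  "row_entries \<sigma> i = {} \<longleftrightarrow> row_entries (tagged (map snd \<sigma>)) i = {}"
proof (induction \<sigma> arbitrary: i)
  case (Cons a \<sigma>)
  then show ?case by (cases a) auto
qed simp

lemma row_entries_tagged:
  "is_reduced n \<rho> \<Longrightarrow>
    word_tab \<rho> ` {x \<in> rothe n (word_act \<rho>). fst x = i} = row_entries (tagged \<rho>) i"
proof (induction \<rho> arbitrary: i)
  case (Cons k \<rho>)
  let ?u = "word_act \<rho>" and ?s = "transpose k (Suc k)"
  have k: "k \<in> {1..<n}" "?u k < ?u (Suc k)" and red: "is_reduced n \<rho>"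
    using Cons.prems by (auto simp: is_reduced_Cons)
  note p = is_reduced_permutes[OF red]
  have row: "{x \<in> rothe n (word_act (k # \<rho>)). fst x = i} =
      (if i = k then {(k, ?u k)} else {}) \<union>
      (\<lambda>(j, c). (?s j, c)) ` {x \<in> rothe n ?u. fst x = ?s i}" (is "?L = ?R")
  proof (intro equalityI subsetI)
    fix x assume "x \<in> ?L"
    then obtain c where x: "x = (i, c)" "(i, c) \<in> rothe n (simple_act k ?u)" by (cases x) auto
    then have "i = k \<and> c = ?u k \<or> (?s i, c) \<in> rothe n ?u" using rothe_simple_act[OF p k] by blast
    then show "x \<in> ?R"
    proof
      assume "(?s i, c) \<in> rothe n ?u"
      then have "(\<lambda>(j, c). (?s j, c)) (?s i, c) \<in> (\<lambda>(j, c). (?s j, c)) ` {x \<in> rothe n ?u. fst x = ?s i}"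
        by (intro imageI) simp
      then show ?thesis using x by simp
    qed (use x in simp)
  next
    fix x assume "x \<in> ?R"
    then consider "i = k" "x = (k, ?u k)" | c where "x = (i, c)" "(?s i, c) \<in> rothe n ?u"
      by (auto split: if_splits)
    then show "x \<in> ?L" by cases (auto simp: rothe_simple_act[OF p k])
  qed
  have "word_tab (k # \<rho>) ` ((\<lambda>(j, c). (?s j, c)) ` {x \<in> rothe n ?u. fst x = ?s i}) =
      word_tab \<rho> ` {x \<in> rothe n ?u. fst x = ?s i}"
    unfolding image_image
  proof (rule image_cong[OF refl])
    fix x assume "x \<in> {x \<in> rothe n ?u. fst x = ?s i}"
    then show "word_tab (k # \<rho>) (case x of (j, c) \<Rightarrow> (?s j, c)) = word_tab \<rho> x"
      using word_tab_old[OF Cons.prems, of "fst x" "snd x"] by (cases x) (simp del: word_tab.simps)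
  qed
  then show ?case unfolding row image_Un Cons.IH[OF red] by simp
qed simp

lemma row_entries_empty:
  assumes red: "is_reduced n (map snd \<sigma>)" and w: "w = word_act (map snd \<sigma>)"
    and "\<And>j. i < j \<Longrightarrow> j \<le> n \<Longrightarrow> w i < w j"
  shows "row_entries \<sigma> i = {}"
proof -
  have "{x \<in> rothe n w. fst x = i} = {}"
    using assms(3) by (fastforce simp: rothe_def)
  then have "row_entries (tagged (map snd \<sigma>)) i = {}"
    unfolding row_entries_tagged[OF red, symmetric] w by (simp only: image_empty)
  then show ?thesis using row_entries_empty_iff by blast
qed

lemma scan_Cons: "j \<le> length \<rho> \<Longrightarrow> scan (x # \<rho>) P k j = scan \<rho> P k j"
proof (induction j arbitrary: k)
  case (Suc j)
  then have "letter (x # \<rho>) (Suc j) = letter \<rho> (Suc j)"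
    by (simp add: letter_def Suc_diff_le)
  then show ?case using Suc by simp
qed simp

lemma scan_eq_scan_list:
  "scan \<rho> P k (length \<rho>) = scan_list k (filter (\<lambda>a. fst a \<notin> P) (tagged \<rho>))"
proof (induction \<rho> arbitrary: k)
  case (Cons x \<rho>)
  have "letter (x # \<rho>) (Suc (length \<rho>)) = x" by (simp add: letter_def)
  moreover have "transpose x (Suc x) k = (if Suc x = k then k - 1 else k)" if "x \<noteq> k"
    using that by auto
  ultimately show ?case using Cons scan_Cons[of "length \<rho>" \<rho> x P] by auto
qed simp

text \<open>Scan and row contents trace the same row index, and tags decrease along the list, so the
  first hit is the largest entry of the row.\<close>

lemma scan_list_eq_Max:
  assumes "sorted_wrt (>) (map fst \<sigma>)" "row_entries \<sigma> k \<noteq> {}"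
  shows "scan_list k \<sigma> = Max (row_entries \<sigma> k)"
  using assms
proof (induction \<sigma> arbitrary: k)
  case (Cons a \<sigma>)
  obtain t x where a: "a = (t, x)" by (cases a)
  show ?case
  proof (cases "x = k")
    case True
    have "Max (row_entries (a # \<sigma>) k) = t"
    proof (rule Max_eqI)
      show "s \<le> t" if "s \<in> row_entries (a # \<sigma>) k" for s
        using that Cons.prems(1) row_entries_subset[of \<sigma> "transpose x (Suc x) k"]
        by (fastforce simp: a True)
    qed (auto simp: a True finite_row_entries)
    then show ?thesis by (simp add: a True)
  next
    case False
    then show ?thesis using Cons by (auto simp: a)
  qed
qed simp

text \<open>
  Going back in time, only values larger than \<open>w k\<close> enter the positions between \<open>k\<close> and \<open>m\<close>, so the
  scan stops exactly when the values \<open>w k\<close> and \<open>w m\<close> are exchanged.  Without this exchange the two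
  values trade places at all later times.
\<close>

lemma scan_list_delete:
  fixes w :: "nat \<Rightarrow> nat"
  assumes "is_reduced n (map snd \<sigma>)" "w = word_act (map snd \<sigma>)" "distinct (map fst \<sigma>)"
    and "1 \<le> k" "k < m" "m \<le> n" "w m < w k"
    and "\<And>i. k < i \<Longrightarrow> i < m \<Longrightarrow> w k < w i"
    and "\<And>i. m < i \<Longrightarrow> i \<le> n \<Longrightarrow> w m < w i"
  defines "j \<equiv> scan_list k \<sigma>" and "\<sigma>' \<equiv> filter (\<lambda>a. fst a \<noteq> scan_list k \<sigma>) \<sigma>"
  shows "j \<in> row_entries \<sigma> k \<and> length \<sigma> = Suc (length \<sigma>') \<and>
    word_act (map snd \<sigma>') = w \<circ> transpose k m \<and>
    row_entries \<sigma>' m = row_entries \<sigma> k - {j} \<and> row_entries \<sigma>' k = row_entries \<sigma> m \<and>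
    (\<forall>i. i \<noteq> k \<longrightarrow> i \<noteq> m \<longrightarrow> row_entries \<sigma>' i = row_entries \<sigma> i)"
  using assms(1-9) unfolding j_def \<sigma>'_def
proof (induction \<sigma> arbitrary: w k m)
  case Nil
  then show ?case by simp
next
  case (Cons a \<sigma>)
  obtain t x where a: "a = (t, x)" by (cases a)
  let ?u = "word_act (map snd \<sigma>)" and ?s = "transpose x (Suc x)"
  have red: "is_reduced n (map snd \<sigma>)" and x: "x \<in> {1..<n}" "?u x < ?u (Suc x)"
    using Cons.prems(1) by (auto simp: a is_reduced_Cons)
  have w: "w i = ?u (?s i)" for i using Cons.prems(2) by (simp add: a simple_act_apply)
  have desc: "w (Suc x) < w x" using x by (simp add: w)
  have t: "t \<notin> fst ` set \<sigma>" and dist: "distinct (map fst \<sigma>)" using Cons.prems(3) by (auto simp: a)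
  then have t_row: "t \<notin> row_entries \<sigma> i" for i using row_entries_subset by blast
  have km: "1 \<le> k" "k < m" "m \<le> n" "w m < w k" using Cons.prems by auto
  note between = Cons.prems(8) and after = Cons.prems(9)
  show ?case
  proof (cases "x = k")
    case True
    \<comment> \<open>The letter \<open>k\<close> makes \<open>k\<close> a descent of
      \<open>w\<close>, whereas all values strictly between positions \<open>k\<close> and
      \<open>m\<close> exceed \<open>w k\<close>.\<close>
    have m: "m = Suc k"
    proof (rule ccontr)
      assume "m \<noteq> Suc k"
      then have "w k < w (Suc k)" using km between by simp
      then show False using desc True by simp
    qed
    have "filter (\<lambda>b. fst b \<noteq> t) \<sigma> = \<sigma>" using t by (auto simp: filter_id_conv)
    moreover have "?u = w \<circ> transpose k m" using m True by (auto simp: w)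
    ultimately show ?thesis using m True t_row by (auto simp: a)
  next
    case False
    have xm: "x \<noteq> m"
    proof
      assume "x = m"
      then have "w m < w (Suc m)" using after x by simp
      then show False using desc \<open>x = m\<close> by simp
    qed
    let ?k = "?s k" and ?m = "?s m"
    have u: "?u i = w (?s i)" for i by (simp add: w)
    have less: "?s i < ?s j \<longleftrightarrow> i < j" if "{i, j} \<noteq> {x, Suc x}" for i j
      using transpose_Suc_less_iff[OF that] .
    let ?j = "scan_list ?k \<sigma>" and ?f = "filter (\<lambda>b. fst b \<noteq> scan_list ?k \<sigma>)"
    have IH: "?j \<in> row_entries \<sigma> ?k \<and> length \<sigma> = Suc (length (?f \<sigma>)) \<and>
      word_act (map snd (?f \<sigma>)) = ?u \<circ> transpose ?k ?m \<and>
      row_entries (?f \<sigma>) ?m = row_entries \<sigma> ?k - {?j} \<and>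
      row_entries (?f \<sigma>) ?k = row_entries \<sigma> ?m \<and>
      (\<forall>i. i \<noteq> ?k \<longrightarrow> i \<noteq> ?m \<longrightarrow> row_entries (?f \<sigma>) i = row_entries \<sigma> i)"
    proof (rule Cons.IH[OF red refl dist])
      show "1 \<le> ?k" using km x by (auto simp: transpose_def)
      show "?k < ?m" using km False by (subst less) (auto simp: doubleton_eq_iff)
      show "?m \<le> n" using km x by (auto simp: transpose_def)
      show "?u ?m < ?u ?k" using km by (simp add: u)
      show "?u ?k < ?u i" if i: "?k < i" "i < ?m" for i
      proof -
        \<comment> \<open>The only newcomer between the two positions arises when the scan steps
          from \<open>k = Suc x\<close> down to \<open>x\<close>: then \<open>i = Suc x\<close>
          holds \<open>w x\<close>, which exceeds \<open>w k\<close> because \<open>x\<close> is a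
          descent of \<open>w\<close>.\<close>
        have "k < ?s i \<and> ?s i < m \<or> i = Suc x \<and> k = Suc x"
          using i False xm by (auto simp: transpose_def split: if_splits)
        then show ?thesis using between[of "?s i"] desc by (auto simp: u)
      qed
      show "?u ?m < ?u i" if i: "?m < i" "i \<le> n" for i
      proof -
        have "m < ?s i \<or> i = Suc x \<and> m = Suc x"
          using i False xm by (auto simp: transpose_def split: if_splits)
        moreover have "?s i \<le> n" using i x by (auto simp: transpose_def)
        ultimately show ?thesis using after[of "?s i"] desc by (auto simp: u)
      qed
    qed
    have tj: "t \<noteq> ?j" using IH t_row by auto
    have "word_act (map snd ((t, x) # ?f \<sigma>)) = w \<circ> transpose k m"
    proof
      fix i
      have "word_act (map snd ((t, x) # ?f \<sigma>)) i = ?u (transpose ?k ?m (?s i))"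
        using IH by (simp add: simple_act_apply)
      also have "transpose ?k ?m (?s i) = ?s (transpose k m i)"
        by (auto simp: transpose_def)
      finally show "word_act (map snd ((t, x) # ?f \<sigma>)) i = (w \<circ> transpose k m) i" by (simp add: w)
    qed
    moreover have "\<forall>i. i \<noteq> k \<longrightarrow> i \<noteq> m \<longrightarrow> row_entries ((t, x) # ?f \<sigma>) i = row_entries ((t, x) # \<sigma>) i"
      using IH by simp
    ultimately show ?thesis using IH False xm tj by (auto simp: a)
  qed
qed

text \<open>The reverse of the tableau reading, because \<open>pairing\<close> lists the values from
  the last index down.\<close>

definition row_reading :: "nat \<Rightarrow> (nat \<Rightarrow> nat set) \<Rightarrow> nat list" where
  "row_reading n f = concat (map (\<lambda>r. rev (sorted_list_of_set (f r))) (rev [1..<Suc n]))"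

lemma sorted_list_of_set_Max:
  fixes A :: "nat set"
  assumes "finite A" "A \<noteq> {}"
  shows "sorted_list_of_set A = sorted_list_of_set (A - {Max A}) @ [Max A]"
proof (rule sorted_distinct_set_unique)
  show "sorted (sorted_list_of_set (A - {Max A}) @ [Max A])"
    using assms by (auto simp: sorted_append)
  show "set (sorted_list_of_set A) = set (sorted_list_of_set (A - {Max A}) @ [Max A])"
    using assms(1) Max_in[OF assms] by (auto simp del: Max_in)
qed (use assms in auto)

lemma upt_split_two:
  assumes "k \<in> {1..<n}"
  shows "rev [1..<Suc n] = rev [Suc (Suc k)..<Suc n] @ [Suc k, k] @ rev [1..<k]"
proof -
  have "[1..<Suc n] = [1..<k] @ [k..<Suc (Suc k)] @ [Suc (Suc k)..<Suc n]"
    using assms upt_add_eq_append[of 1 k "Suc n - k"] upt_add_eq_append[of k "Suc (Suc k)" "n - Suc k"]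
    by auto
  also have "[k..<Suc (Suc k)] = [k, Suc k]" by simp
  finally show ?thesis by simp
qed

text \<open>Row \<open>k\<close> is the topmost nonempty row, so its maximum is read first. In
  \<open>g\<close> the rest of this row sits in row \<open>Suc k\<close>, and it is still read
  before the lower rows.\<close>

lemma row_reading_step:
  assumes k: "k \<in> {1..<n}" and f: "finite (f k)" "f k \<noteq> {}"
    and above: "\<And>i. k < i \<Longrightarrow> i \<le> n \<Longrightarrow> f i = {}"
    and g: "g (Suc k) = f k - {Max (f k)}" "g k = {}" "\<And>i. i \<noteq> k \<Longrightarrow> i \<noteq> Suc k \<Longrightarrow> g i = f i"
  shows "row_reading n f = Max (f k) # row_reading n g"
proof -
  let ?h = "\<lambda>f r. rev (sorted_list_of_set (f r :: nat set))"
  have top: "concat (map (?h f) (rev [Suc (Suc k)..<Suc n])) = []"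
    "concat (map (?h g) (rev [Suc (Suc k)..<Suc n])) = []"
    using above g(3) by auto
  have low: "map (?h f) (rev [1..<k]) = map (?h g) (rev [1..<k])"
    using g(3) by auto
  have "?h f (Suc k) = []" using above[of "Suc k"] k by simp
  moreover have "?h g k = []" using g(2) by simp
  moreover have "?h f k = Max (f k) # ?h g (Suc k)"
    using sorted_list_of_set_Max[OF f] g(1) by simp
  ultimately show ?thesis
    unfolding row_reading_def upt_split_two[OF k] map_append concat_append top low
    by simp
qed

text \<open>Induction on the number of unpaired letters, with the invariant that these letters form
  a reduced word of the permutation whose super-Yamanouchi word remains to be processed.\<close>

lemma pairing_eq_row_reading:
  fixes P :: "nat set" and \<rho> :: "nat list"
  defines "\<sigma> \<equiv> filter (\<lambda>a. fst a \<notin> P) (tagged \<rho>)"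
  assumes "is_reduced n (map snd \<sigma>)"
  shows "pairing \<rho> P (sy_word n (word_act (map snd \<sigma>))) = row_reading n (row_entries \<sigma>)"
  using assms(2) unfolding \<sigma>_def
proof (induction "length (filter (\<lambda>a. fst a \<notin> P) (tagged \<rho>))" arbitrary: P)
  case 0
  then have "filter (\<lambda>a. fst a \<notin> P) (tagged \<rho>) = []" by simp
  then show ?case by (simp only: list.map word_act_Nil sy_word_id pairing.simps)
      (simp add: row_reading_def)
next
  case (Suc l)
  define \<sigma> where "\<sigma> = filter (\<lambda>a. fst a \<notin> P) (tagged \<rho>)"
  define w where "w = word_act (map snd \<sigma>)"
  have red: "is_reduced n (map snd \<sigma>)" using Suc.prems by (simp add: \<sigma>_def)
  have len: "length \<sigma> = Suc l" using Suc.hyps(2) by (simp add: \<sigma>_def)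
  have p: "w permutes {1..n}" unfolding w_def by (rule is_reduced_permutes[OF red])
  have "perm_length n w = length \<sigma>" using red by (simp add: is_reduced_def w_def)
  then have "w \<noteq> id" using len by auto
  then obtain k where last: "last_descent n w k" using exists_last_descent[OF p] by blast
  then have k: "k \<in> {1..<n}" "w (Suc k) < w k" and mono: "strict_mono_on {Suc k..n} w"
    by (auto simp: last_descent_def)
  have mono': "w i < w j" if "k < i" "i < j" "j \<le> n" for i j
    using that by (intro strict_mono_onD[OF mono]) auto
  have sorted: "sorted_wrt (>) (map fst \<sigma>)"
    using sorted_tagged[of \<rho>] by (auto simp: \<sigma>_def sorted_wrt_map intro: sorted_wrt_filter)
  then have dist: "distinct (map fst \<sigma>)"
    using strict_sorted_iff[of "rev (map fst \<sigma>)"] by (simp add: sorted_wrt_rev)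
  define j where "j = scan_list k \<sigma>"
  define \<sigma>' where "\<sigma>' = filter (\<lambda>a. fst a \<noteq> j) \<sigma>"
  \<comment> \<open>The instance \<open>m = Suc k\<close>; a general \<open>m\<close> arises only
    inside the induction of \<open>scan_list_delete\<close>, where the two values drift apart going
    back in time.\<close>
  have del: "j \<in> row_entries \<sigma> k" "length \<sigma> = Suc (length \<sigma>')"
    "word_act (map snd \<sigma>') = w \<circ> transpose k (Suc k)"
    "row_entries \<sigma>' (Suc k) = row_entries \<sigma> k - {j}"
    "row_entries \<sigma>' k = row_entries \<sigma> (Suc k)"
    "\<And>i. i \<noteq> k \<Longrightarrow> i \<noteq> Suc k \<Longrightarrow> row_entries \<sigma>' i = row_entries \<sigma> i"
    using scan_list_delete[OF red w_def dist, of k "Suc k"] k mono' by (auto simp: j_def \<sigma>'_def)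
  have \<sigma>'_eq: "\<sigma>' = filter (\<lambda>a. fst a \<notin> insert j P) (tagged \<rho>)"
    by (auto simp: \<sigma>'_def \<sigma>_def intro!: filter_cong)
  have act: "word_act (map snd \<sigma>') = simple_act k w" using del(3) by (simp add: simple_act_def)
  have red': "is_reduced n (map snd \<sigma>')"
    unfolding is_reduced_def act
    using red del(2) perm_length_simple_act_descent[OF k]
    by (auto simp: is_reduced_def w_def \<sigma>'_def)
  have above: "row_entries \<sigma> i = {}" if "k < i" "i \<le> n" for i
    using row_entries_empty[OF red w_def] mono' that by blast
  have Max: "j = Max (row_entries \<sigma> k)"
    using scan_list_eq_Max[OF sorted] del(1) unfolding j_def by blast
  have "row_reading n (row_entries \<sigma>) = j # row_reading n (row_entries \<sigma>')"
    unfolding Max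
    by (rule row_reading_step) (use k finite_row_entries del above Max in auto)
  moreover have "scan \<rho> P k (length \<rho>) = j"
    unfolding scan_eq_scan_list j_def \<sigma>_def ..
  moreover have "pairing \<rho> (insert j P) (sy_word n (simple_act k w)) = row_reading n (row_entries \<sigma>')"
    using Suc.hyps(1)[of "insert j P"] red' act del(2) len unfolding \<sigma>'_eq by auto
  ultimately show ?case
    unfolding \<sigma>_def[symmetric] w_def[symmetric] sy_word_Cons[OF p last] by simp
qed

section \<open>Comparison of the two permutations, and recovery of the word\<close>

lemma length_pairing [simp]: "length (pairing \<rho> P ks) = length ks"
  by (induction ks arbitrary: P) (auto simp: Let_def)

lemma tableau_row:
  assumes "\<rho> \<in> reduced_words n w"
  shows "tableau n \<rho> ` {x \<in> rothe n w. fst x = i} = row_entries (tagged \<rho>) i"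
proof -
  have red: "is_reduced n \<rho>" and w: "word_act \<rho> = w" using assms by (auto simp: reduced_words_iff)
  have "tableau n \<rho> ` {x \<in> rothe n w. fst x = i} = word_tab \<rho> ` {x \<in> rothe n w. fst x = i}"
    by (rule image_cong) (auto simp: tableau_def w)
  then show ?thesis using row_entries_tagged[OF red, of i] w by simp
qed

lemma pairing_eq_tab_reading:
  assumes "\<rho> \<in> reduced_words n w"
  shows "pairing \<rho> {} (sy_word n w) = rev (tab_reading n w (tableau n \<rho>))"
proof -
  have red: "is_reduced n \<rho>" and w: "word_act \<rho> = w" using assms by (auto simp: reduced_words_iff)
  have "pairing \<rho> {} (sy_word n w) = row_reading n (row_entries (tagged \<rho>))"
    using pairing_eq_row_reading[of n "{}" \<rho>] red w by simp
  also have "\<dots> = rev (tab_reading n w (tableau n \<rho>))"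
    unfolding row_reading_def tab_reading_def tableau_row[OF assms]
    by (simp add: rev_concat rev_map o_def del: upt_Suc)
  finally show ?thesis .
qed

lemma length_tab_reading:
  assumes "\<rho> \<in> reduced_words n w"
  shows "length (tab_reading n w (tableau n \<rho>)) = perm_length n w"
proof -
  have "w permutes {1..n}" using assms is_reduced_permutes by (auto simp: reduced_words_iff)
  then have "length (sy_word n w) = perm_length n w"
    using sy_word_reduced by (auto simp: reduced_words_def)
  then show ?thesis
    using arg_cong[OF pairing_eq_tab_reading[OF assms], of length] by simp
qed

lemma word_perm_eq_tab_perm:
  assumes "\<rho> \<in> reduced_words n w"
  shows "word_perm n w \<rho> = tab_perm n w (tableau n \<rho>)"
proof
  fix i
  show "word_perm n w \<rho> i = tab_perm n w (tableau n \<rho>) i"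
    using length_tab_reading[OF assms]
    by (auto simp: word_perm_def tab_perm_def pairing_eq_tab_reading[OF assms] letter_def rev_nth
        Suc_diff_Suc One_nat_def)
qed

text \<open>The latest tag lies in the row numbered by the head letter, which is thus determined.
  Removing this tag and swapping the rows back gives the row contents of the tail.\<close>

lemma row_entries_tagged_inj:
  assumes "length \<rho> = length \<rho>'" "\<And>i. row_entries (tagged \<rho>) i = row_entries (tagged \<rho>') i"
  shows "\<rho> = \<rho>'"
  using assms
proof (induction \<rho> \<rho>' rule: list_induct2)
  case (Cons x \<rho> y \<rho>')
  have new: "Suc (length \<rho>) \<notin> row_entries (tagged \<rho>) i" "Suc (length \<rho>) \<notin> row_entries (tagged \<rho>') i" for i
    using row_entries_subset[of "tagged \<rho>" i] row_entries_subset[of "tagged \<rho>'" i] Cons.hyps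
    unfolding fst_tagged by auto
  have "Suc (length \<rho>) \<in> row_entries (tagged (x # \<rho>)) x" by simp
  then have "Suc (length \<rho>) \<in> row_entries (tagged (y # \<rho>')) x" using Cons.prems by blast
  then have xy: "x = y" using new by (auto split: if_splits)
  have "row_entries (tagged \<rho>) i = row_entries (tagged \<rho>') i" for i
  proof -
    have "row_entries (tagged \<rho>) i = row_entries (tagged (x # \<rho>)) (transpose x (Suc x) i) - {Suc (length \<rho>)}"
      using new by auto
    moreover have "row_entries (tagged \<rho>') i = row_entries (tagged (y # \<rho>')) (transpose x (Suc x) i) - {Suc (length \<rho>)}"
      using new xy Cons.hyps by auto
    ultimately show ?thesis using Cons.prems[of "transpose x (Suc x) i"] by (simp only:)
  qed
  then show ?case using Cons.IH xy by simp
qed simp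

text \<open>The row lengths are prescribed by the diagram, so the reading splits into rows in only
  one way, and the row contents determine the word.\<close>

lemma tab_perm_inj:
  assumes \<rho>: "\<rho> \<in> reduced_words n w" and \<rho>': "\<rho>' \<in> reduced_words n w"
    and eq: "tab_perm n w (tableau n \<rho>) = tab_perm n w (tableau n \<rho>')"
  shows "\<rho> = \<rho>'"
proof (rule row_entries_tagged_inj)
  show "length \<rho> = length \<rho>'" using \<rho> \<rho>' by (simp add: reduced_words_def)
  have "tab_reading n w (tableau n \<rho>) = tab_reading n w (tableau n \<rho>')"
  proof (rule nth_equalityI)
    show "length (tab_reading n w (tableau n \<rho>)) = length (tab_reading n w (tableau n \<rho>'))"
      using length_tab_reading \<rho> \<rho>' by simp
    fix i assume "i < length (tab_reading n w (tableau n \<rho>))"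
    then have "Suc i \<in> {1..perm_length n w}" using length_tab_reading[OF \<rho>] by simp
    then show "tab_reading n w (tableau n \<rho>) ! i = tab_reading n w (tableau n \<rho>') ! i"
      using fun_cong[OF eq, of "Suc i"] by (simp add: tab_perm_def)
  qed
  moreover have card: "card (row_entries (tagged \<rho>) i) = card {x \<in> rothe n w. fst x = i}"
    if "\<rho> \<in> reduced_words n w" for \<rho> i
  proof -
    have "inj_on (tableau n \<rho>) (rothe n w)"
      using tableau_in_SBT[OF that] by (auto simp: SBT_iff bij_betw_def)
    then have "inj_on (tableau n \<rho>) {x \<in> rothe n w. fst x = i}"
      by (rule inj_on_subset) auto
    then show ?thesis using tableau_row[OF that, of i] card_image by metis
  qed
  ultimately have eq_rows: "map (\<lambda>r. sorted_list_of_set (row_entries (tagged \<rho>) r)) [1..<Suc n] =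
      map (\<lambda>r. sorted_list_of_set (row_entries (tagged \<rho>') r)) [1..<Suc n]"
    unfolding tab_reading_def tableau_row[OF \<rho>] tableau_row[OF \<rho>']
    using card[OF \<rho>] card[OF \<rho>']
    by (intro concat_injective) (auto simp: zip_map_map zip_same_conv_map simp del: upt_Suc)
  have *: "row_entries (tagged \<rho>) i = row_entries (tagged \<rho>') i" if "i \<in> {1..n}" for i
  proof -
    have "i \<in> set [1..<Suc n]" using that by (simp del: upt_Suc)
    then have "sorted_list_of_set (row_entries (tagged \<rho>) i) = sorted_list_of_set (row_entries (tagged \<rho>') i)"
      using map_eq_conv[THEN iffD1, rule_format, OF eq_rows] by blast
    then show ?thesis by (metis set_sorted_list_of_set finite_row_entries)
  qed
  fix i
  show "row_entries (tagged \<rho>) i = row_entries (tagged \<rho>') i"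
  proof (cases "i \<in> {1..n}")
    case False
    then have "{x \<in> rothe n w. fst x = i} = {}" using rothe_bounds by fastforce
    then show ?thesis
      unfolding tableau_row[OF \<rho>, symmetric] tableau_row[OF \<rho>', symmetric] by (simp only: image_empty)
  qed (rule *)
qed

section \<open>Inversion numbers\<close>

definition row_size :: "nat \<Rightarrow> (nat \<Rightarrow> nat) \<Rightarrow> nat \<Rightarrow> nat" where
  "row_size n w i = card {c. (i, c) \<in> rothe n w}"

text \<open>
  The super-Yamanouchi word is the concatenation of the runs \<open>i, i + 1, \<dots>, i + row_size n w i - 1\<close>.
\<close>

definition sy_sum :: "nat \<Rightarrow> (nat \<Rightarrow> nat) \<Rightarrow> nat" where
  "sy_sum n w = (\<Sum>i = 1..n. \<Sum>j < row_size n w i. i + j)"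

lemma row_size_simple_act:
  assumes p: "u permutes {1..n}" and k: "k \<in> {1..<n}" and less: "u k < u (Suc k)"
  shows "row_size n (simple_act k u) k = Suc (row_size n u (Suc k))"
    and "row_size n (simple_act k u) (Suc k) = row_size n u k"
    and "i \<noteq> k \<Longrightarrow> i \<noteq> Suc k \<Longrightarrow> row_size n (simple_act k u) i = row_size n u i"
proof -
  note D = rothe_simple_act[OF p k less]
  have "{c. (k, c) \<in> rothe n (simple_act k u)} = insert (u k) {c. (Suc k, c) \<in> rothe n u}"
    by (auto simp: D)
  then show "row_size n (simple_act k u) k = Suc (row_size n u (Suc k))"
    unfolding row_size_def
    using rothe_new_cell[OF p, of k] rothe_finite_row_col(1)[OF p, of "Suc k" "\<lambda>_. True"] by simp
  show "row_size n (simple_act k u) (Suc k) = row_size n u k"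
    unfolding row_size_def by (simp add: D)
  show "row_size n (simple_act k u) i = row_size n u i" if "i \<noteq> k" "i \<noteq> Suc k"
    unfolding row_size_def using that by (simp add: D)
qed

text \<open>The run of row \<open>Suc k\<close> becomes that of row \<open>k\<close> by putting the
  letter \<open>k\<close> in front; the run of row \<open>k\<close> moves to row
  \<open>Suc k\<close>, which raises each of its letters by one.\<close>

lemma sy_sum_simple_act:
  assumes p: "u permutes {1..n}" and k: "k \<in> {1..<n}" and less: "u k < u (Suc k)"
  shows "sy_sum n (simple_act k u) = sy_sum n u + k + row_size n u k"
proof -
  let ?w = "simple_act k u"
  let ?g = "\<lambda>i m. \<Sum>j < m. i + (j :: nat)"
  have I: "{1..n} = insert k (insert (Suc k) ({1..n} - {k, Suc k}))" using k by auto
  have split: "sy_sum n v = ?g k (row_size n v k) + ?g (Suc k) (row_size n v (Suc k)) +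
      (\<Sum>i \<in> {1..n} - {k, Suc k}. ?g i (row_size n v i))" for v
    unfolding sy_sum_def by (subst I) simp
  have g: "?g (Suc k) m = ?g k m + m" for m by (induction m) auto
  have "(\<Sum>i \<in> {1..n} - {k, Suc k}. ?g i (row_size n ?w i)) =
      (\<Sum>i \<in> {1..n} - {k, Suc k}. ?g i (row_size n u i))"
    by (rule sum.cong) (auto simp: row_size_simple_act(3)[OF assms])
  then show ?thesis
    unfolding split[of ?w] split[of u] row_size_simple_act(1,2)[OF assms] g by simp
qed

definition column_inv :: "(nat \<times> nat) set \<Rightarrow> (nat \<times> nat \<Rightarrow> nat) \<Rightarrow> nat" where
  "column_inv D T = (\<Sum>(r, c) \<in> D. above_count D T r c)"

text \<open>By \<open>above_count_simple_act\<close>, exactly the cells of row \<open>Suc k\<close>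
  in columns below \<open>u k\<close> gain one, where \<open>u\<close> is the permutation of
  \<open>\<rho>\<close>; by \<open>rothe_row_Suc\<close> they correspond to row \<open>k\<close> of
  its diagram.\<close>

lemma column_inv_word_tab:
  assumes red: "is_reduced n (k # \<rho>)"
  shows "column_inv (rothe n (word_act (k # \<rho>))) (word_tab (k # \<rho>)) =
    column_inv (rothe n (word_act \<rho>)) (word_tab \<rho>) + row_size n (word_act \<rho>) k"
proof -
  let ?u = "word_act \<rho>" and ?s = "transpose k (Suc k)"
  have k: "k \<in> {1..<n}" "?u k < ?u (Suc k)" and red': "is_reduced n \<rho>"
    using red by (auto simp: is_reduced_Cons)
  note p = is_reduced_permutes[OF red']
  let ?D = "rothe n (simple_act k ?u)" and ?D' = "rothe n ?u"
  let ?f = "\<lambda>(i, c). (?s i, c :: nat)"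
  have fin: "finite ?D'" by (rule finite_rothe[OF p])
  note D = rothe_simple_act_insert[OF p k]
  have new: "(k, ?u k) \<notin> ?f ` ?D'" using rothe_new_cell[OF p, of k] by auto
  have inj: "inj_on ?f ?D'" by (auto simp: inj_on_def)
  have above: "above_count ?D (word_tab (k # \<rho>)) (?s i) c =
      above_count ?D' (word_tab \<rho>) i c + (if i = Suc k \<and> c < ?u k then 1 else 0)"
    if "(i, c) \<in> ?D'" for i c
    using that word_tab_less[of \<rho>] word_tab_old[OF red] word_tab_rows_less[OF red]
    by (intro above_count_simple_act[OF p k, where l = "Suc (length \<rho>)"]) auto
  have "column_inv ?D (word_tab (k # \<rho>)) =
      above_count ?D (word_tab (k # \<rho>)) k (?u k) +
      (\<Sum>x \<in> ?f ` ?D'. case x of (r, c) \<Rightarrow> above_count ?D (word_tab (k # \<rho>)) r c)"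
    unfolding column_inv_def by (subst (1) D) (simp add: fin new)
  also have "above_count ?D (word_tab (k # \<rho>)) k (?u k) = 0"
    by (rule above_count_new_cell[OF p k(1)])
  also have "(\<Sum>x \<in> ?f ` ?D'. case x of (r, c) \<Rightarrow> above_count ?D (word_tab (k # \<rho>)) r c) =
      (\<Sum>(i, c) \<in> ?D'. above_count ?D (word_tab (k # \<rho>)) (?s i) c)"
    by (subst sum.reindex[OF inj]) (auto intro: sum.cong)
  also have "\<dots> = (\<Sum>(i, c) \<in> ?D'. above_count ?D' (word_tab \<rho>) i c +
      (if i = Suc k \<and> c < ?u k then 1 else 0))"
    by (rule sum.cong) (auto simp: above simp del: word_tab.simps)
  also have "\<dots> = column_inv ?D' (word_tab \<rho>) +
      (\<Sum>x \<in> ?D'. if fst x = Suc k \<and> snd x < ?u k then 1 else 0)"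
    by (simp add: column_inv_def sum.distrib case_prod_beta)
  also have "(\<Sum>x \<in> ?D'. if fst x = Suc k \<and> snd x < ?u k then 1 else 0 :: nat) =
      card {x \<in> ?D'. fst x = Suc k \<and> snd x < ?u k}"
    using fin by (simp add: sum.If_cases Int_def)
  also have "{x \<in> ?D'. fst x = Suc k \<and> snd x < ?u k} = Pair (Suc k) ` {c. (k, c) \<in> ?D'}"
    using rothe_row_Suc[OF p k] by force
  also have "card \<dots> = row_size n ?u k"
    unfolding row_size_def by (rule card_image) (simp add: inj_on_def)
  finally show ?thesis by simp
qed

lemma sum_list_plus_column_inv:
  "is_reduced n \<rho> \<Longrightarrow>
    sum_list \<rho> + column_inv (rothe n (word_act \<rho>)) (word_tab \<rho>) = sy_sum n (word_act \<rho>)"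
proof (induction \<rho>)
  case Nil
  have "row_size n id i = 0" for i by (simp add: row_size_def)
  then show ?case by (simp add: column_inv_def sy_sum_def del: id_apply)
next
  case (Cons k \<rho>)
  have k: "k \<in> {1..<n}" "word_act \<rho> k < word_act \<rho> (Suc k)" and red: "is_reduced n \<rho>"
    using Cons.prems by (auto simp: is_reduced_Cons)
  show ?case
    using column_inv_word_tab[OF Cons.prems] Cons.IH[OF red]
      sy_sum_simple_act[OF is_reduced_permutes[OF red] k] by simp
qed

text \<open>After the last descent \<open>k\<close> the values increase, so row \<open>Suc k\<close>
  of \<open>w\<close> is empty and \<open>sy_sum\<close> grows by the letter \<open>k\<close>
  alone.\<close>

lemma sum_list_sy_word:
  "w permutes {1..n} \<Longrightarrow> sum_list (sy_word n w) = sy_sum n w"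
proof (induction "perm_length n w" arbitrary: w rule: less_induct)
  case less
  note p = less.prems
  show ?case
  proof (cases "w = id")
    case True
    have "row_size n id i = 0" for i by (simp add: row_size_def)
    then show ?thesis unfolding True sy_word_id by (simp add: sy_sum_def del: id_apply)
  next
    case False
    then obtain k where last: "last_descent n w k" using exists_last_descent[OF p] by blast
    then have k: "k \<in> {1..<n}" "w (Suc k) < w k" and mono: "strict_mono_on {Suc k..n} w"
      by (auto simp: last_descent_def)
    let ?u = "simple_act k w"
    have u: "?u permutes {1..n}" "?u k < ?u (Suc k)"
      using simple_act_permutes[OF p k(1)] k by (auto simp: simple_act_apply)
    have "{c. (Suc k, c) \<in> rothe n w} = {}"
    proof -
      have "w (Suc k) < w j" if "Suc k < j" "j \<le> n" for j
        using that by (intro strict_mono_onD[OF mono]) auto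
      then show ?thesis by (fastforce simp: rothe_def)
    qed
    then have "row_size n w (Suc k) = 0" unfolding row_size_def by (simp only: card.empty)
    then have "row_size n ?u k = 0"
      using row_size_simple_act(2)[OF u(1) k(1) u(2)] by simp
    then have "sy_sum n w = sy_sum n ?u + k"
      using sy_sum_simple_act[OF u(1) k(1) u(2)] by simp
    moreover have "sum_list (sy_word n ?u) = sy_sum n ?u"
      using less.hyps[OF _ u(1)] perm_length_simple_act_descent[OF k] by simp
    ultimately show ?thesis unfolding sy_word_Cons[OF p last] by simp
  qed
qed

lemma sum_letters: "(\<Sum>i = 1..length \<rho>. letter \<rho> i) = sum_list \<rho>"
proof (induction \<rho>)
  case (Cons x \<rho>)
  have "letter (x # \<rho>) i = letter \<rho> i" if "i \<in> {1..length \<rho>}" for i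
    using that by (cases i) (auto simp: letter_def Suc_diff_le)
  then have "(\<Sum>i = 1..length \<rho>. letter (x # \<rho>) i) = sum_list \<rho>" using Cons by simp
  moreover have "letter (x # \<rho>) (Suc (length \<rho>)) = x" by (simp add: letter_def)
  ultimately show ?case by simp
qed simp

section \<open>Inversions of the reading permutation\<close>

lemma sorted_wrt_concat:
  assumes "\<And>xs. xs \<in> set xss \<Longrightarrow> sorted_wrt P xs"
    and "sorted_wrt (\<lambda>xs ys. \<forall>x \<in> set xs. \<forall>y \<in> set ys. P x y) xss"
  shows "sorted_wrt P (concat xss)"
  using assms by (induction xss) (auto simp: sorted_wrt_append)

text \<open>The reading is sorted by row and, within a row, by entry. Hence a smaller entry read
  after a larger one must lie in a strictly higher row.\<close>

lemma perm_length_tab_perm: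
  assumes \<rho>: "\<rho> \<in> reduced_words n w"
  defines "D \<equiv> rothe n w" and "T \<equiv> tableau n \<rho>"
  shows "perm_length (perm_length n w) (tab_perm n w T) =
    card {(x, y). x \<in> D \<and> y \<in> D \<and> T x < T y \<and> fst x > fst y}"
proof -
  let ?l = "perm_length n w" and ?L = "tab_reading n w T"
  have len: "length ?L = ?l" unfolding T_def by (rule length_tab_reading[OF \<rho>])
  have p: "w permutes {1..n}" using \<rho> is_reduced_permutes by (auto simp: reduced_words_iff)
  have inj: "inj_on T D"
    using tableau_in_SBT[OF \<rho>] by (auto simp: SBT_iff bij_betw_def D_def T_def)
  have finD: "finite D" unfolding D_def by (rule finite_rothe[OF p])
  define row where "row v = fst (the_inv_into D T v)" for v
  have row_T: "row (T x) = fst x" if "x \<in> D" for x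
    using that inj by (simp add: row_def the_inv_into_f_f)
  have row_mem: "row v = r" if "v \<in> T ` {x \<in> D. fst x = r}" for v r
    using that row_T by auto
  let ?lex = "\<lambda>u v. row u < row v \<or> row u = row v \<and> u < v"
  have finrow: "finite (T ` {x \<in> D. fst x = r})" for r using finD by simp
  have sorted: "sorted_wrt ?lex ?L"
    unfolding tab_reading_def D_def[symmetric]
  proof (rule sorted_wrt_concat)
    fix xs assume "xs \<in> set (map (\<lambda>r. sorted_list_of_set (T ` {x \<in> D. fst x = r})) [1..<Suc n])"
    then obtain r where xs: "xs = sorted_list_of_set (T ` {x \<in> D. fst x = r})" by auto
    have "sorted_wrt (<) xs" unfolding xs by simp
    then show "sorted_wrt ?lex xs"
      by (rule sorted_wrt_mono_rel[rotated]) (use row_mem finrow in \<open>auto simp: xs\<close>)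
  next
    have "sorted_wrt (<) [1..<Suc n]" by (rule sorted_wrt_upt)
    then show "sorted_wrt (\<lambda>xs ys. \<forall>x \<in> set xs. \<forall>y \<in> set ys. ?lex x y)
        (map (\<lambda>r. sorted_list_of_set (T ` {x \<in> D. fst x = r})) [1..<Suc n])"
      unfolding sorted_wrt_map
      by (rule sorted_wrt_mono_rel[rotated]) (use row_T finrow in auto)
  qed
  have set_L: "set ?L = T ` D"
    using finrow rothe_bounds unfolding tab_reading_def D_def[symmetric]
    by (fastforce simp: D_def simp del: upt_Suc)
  define cell where "cell i = the_inv_into D T (?L ! (i - 1))" for i
  have cell: "cell i \<in> D" "T (cell i) = ?L ! (i - 1)" if "i \<in> {1..?l}" for i
  proof -
    have "?L ! (i - 1) \<in> T ` D" unfolding set_L[symmetric] using that len by (intro nth_mem) auto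
    then show "cell i \<in> D" "T (cell i) = ?L ! (i - 1)"
      unfolding cell_def using inj by (auto simp: the_inv_into_f_f f_the_inv_into_f)
  qed
  have lex: "fst (cell i) < fst (cell j) \<or> fst (cell i) = fst (cell j) \<and> T (cell i) < T (cell j)"
    if "1 \<le> i" "i < j" "j \<le> ?l" for i j
  proof -
    have "?lex (?L ! (i - 1)) (?L ! (j - 1))"
      using that len by (intro sorted_wrt_nth_less[OF sorted]) auto
    moreover have ij: "i \<in> {1..?l}" "j \<in> {1..?l}" using that by auto
    ultimately show ?thesis
      using row_T[OF cell(1)[OF ij(1)]] row_T[OF cell(1)[OF ij(2)]] cell(2)[OF ij(1)] cell(2)[OF ij(2)]
      by simp
  qed
  have cell_surj: "\<exists>i \<in> {1..?l}. cell i = x" if "x \<in> D" for x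
  proof -
    have "T x \<in> set ?L" using set_L that by blast
    then obtain i where i: "i < ?l" "?L ! i = T x" using len by (auto simp: in_set_conv_nth)
    then have "cell (Suc i) = x" using inj that by (simp add: cell_def the_inv_into_f_f)
    then show ?thesis using i by (intro bexI[of _ "Suc i"]) auto
  qed
  let ?I = "{(i, j). 1 \<le> i \<and> i < j \<and> j \<le> ?l \<and> tab_perm n w T i > tab_perm n w T j}"
  let ?J = "{(x, y). x \<in> D \<and> y \<in> D \<and> T x < T y \<and> fst x > fst y}"
  have tp: "tab_perm n w T i = T (cell i)" if "1 \<le> i" "i \<le> ?l" for i
    using cell[of i] that by (simp add: tab_perm_def)
  \<comment> \<open>The earlier position carries the larger entry in the lower row, hence the
    swapped pair.\<close>
  have "bij_betw (\<lambda>(i, j). (cell j, cell i)) ?I ?J"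
  proof (rule bij_betw_imageI)
    have "cell i \<noteq> cell j" if "1 \<le> i" "i < j" "j \<le> ?l" for i j
      using lex[OF that] by auto
    then have "inj_on cell {1..?l}" by (intro linorder_inj_onI) auto
    then have "inj_on (map_prod cell cell \<circ> prod.swap) ({1..?l} \<times> {1..?l})"
      by (intro comp_inj_on inj_swap) (simp add: product_swap map_prod_inj_on)
    moreover have "map_prod cell cell \<circ> prod.swap = (\<lambda>(i, j). (cell j, cell i))" by auto
    ultimately have "inj_on (\<lambda>(i, j). (cell j, cell i)) ({1..?l} \<times> {1..?l})" by (simp only:)
    then show "inj_on (\<lambda>(i, j). (cell j, cell i)) ?I" by (rule inj_on_subset) auto
    show "(\<lambda>(i, j). (cell j, cell i)) ` ?I = ?J"
    proof (intro equalityI subsetI)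
      fix z assume "z \<in> (\<lambda>(i, j). (cell j, cell i)) ` ?I"
      then obtain i j where z: "z = (cell j, cell i)" "1 \<le> i" "i < j" "j \<le> ?l"
        "tab_perm n w T i > tab_perm n w T j" by auto
      then have "T (cell i) > T (cell j)" using tp[of i] tp[of j] by simp
      then show "z \<in> ?J" using lex[of i j] cell(1)[of i] cell(1)[of j] z by auto
    next
      fix z assume "z \<in> ?J"
      then obtain x y where z: "z = (x, y)" "x \<in> D" "y \<in> D" "T x < T y" "fst y < fst x" by auto
      obtain i j where ij: "i \<in> {1..?l}" "cell i = y" "j \<in> {1..?l}" "cell j = x"
        using cell_surj z by blast
      have "i < j"
      proof (rule ccontr)
        assume "\<not> i < j"
        then have "i = j \<or> j < i" by auto
        then show False using lex[of j i] ij z by auto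
      qed
      then have "(i, j) \<in> ?I" using ij z tp[of i] tp[of j] by auto
      then have "(\<lambda>(i, j). (cell j, cell i)) (i, j) \<in> (\<lambda>(i, j). (cell j, cell i)) ` ?I"
        by (rule imageI)
      then show "z \<in> (\<lambda>(i, j). (cell j, cell i)) ` ?I" using z ij by simp
    qed
  qed
  then show ?thesis unfolding perm_length_def[of ?l] by (rule bij_betw_same_card)
qed

lemma column_inv_eq_card:
  assumes fin: "finite D"
  shows "column_inv D T =
    card {(x, y). x \<in> D \<and> y \<in> D \<and> T x < T y \<and> fst x > fst y \<and> snd x = snd y}"
proof -
  let ?A = "\<lambda>y. {r'. (r', snd y) \<in> D \<and> fst y < r' \<and> T (r', snd y) < T y}"
  have finA: "finite (?A y)" for y
    by (rule finite_subset[of _ "fst ` D"]) (use fin in force)+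
  have "column_inv D T = (\<Sum>y \<in> D. card (?A y))"
    unfolding column_inv_def above_count_def by (simp add: case_prod_beta)
  also have "\<dots> = card (SIGMA y:D. ?A y)" using fin finA by (simp add: card_SigmaI)
  also have "\<dots> = card {(x, y). x \<in> D \<and> y \<in> D \<and> T x < T y \<and> fst x > fst y \<and> snd x = snd y}"
  proof (rule bij_betw_same_card)
    show "bij_betw (\<lambda>(y, r). ((r, snd y), y)) (SIGMA y:D. ?A y)
        {(x, y). x \<in> D \<and> y \<in> D \<and> T x < T y \<and> fst x > fst y \<and> snd x = snd y}"
      by (rule bij_betw_byWitness[where f' = "\<lambda>(x, y). (y, fst x)"]) auto
  qed
  finally show ?thesis .
qed

lemma column_inv_cong:
  assumes "\<And>x. x \<in> D \<Longrightarrow> T x = T' x"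
  shows "column_inv D T = column_inv D T'"
  unfolding column_inv_def above_count_def using assms
  by (auto intro!: sum.cong arg_cong[where f = card])

text \<open>Inversions of the reading split by whether the two cells share a column. Those that do
  number \<open>sum_list (sy_word n w) - sum_list \<rho>\<close>, which is the correction term of
  \<open>word_inv\<close>.\<close>

lemma tab_inv_eq_word_inv:
  assumes \<rho>: "\<rho> \<in> reduced_words n w"
  shows "tab_inv (rothe n w) (tableau n \<rho>) = word_inv n w \<rho>"
proof -
  let ?D = "rothe n w" and ?T = "tableau n \<rho>" and ?\<pi> = "sy_word n w"
  have red: "is_reduced n \<rho>" and w: "word_act \<rho> = w" using \<rho> by (auto simp: reduced_words_iff)
  have p: "w permutes {1..n}" using is_reduced_permutes[OF red] w by simp
  have fin: "finite ?D" by (rule finite_rothe[OF p])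
  let ?A = "{(x, y). x \<in> ?D \<and> y \<in> ?D \<and> ?T x < ?T y \<and> fst x > fst y \<and> snd x \<noteq> snd y}"
  let ?B = "{(x, y). x \<in> ?D \<and> y \<in> ?D \<and> ?T x < ?T y \<and> fst x > fst y \<and> snd x = snd y}"
  have "finite ?A" "finite ?B"
    by (rule finite_subset[of _ "?D \<times> ?D"]; use fin in auto)+
  then have "card (?A \<union> ?B) = card ?A + card ?B" by (intro card_Un_disjoint) auto
  moreover have "{(x, y). x \<in> ?D \<and> y \<in> ?D \<and> ?T x < ?T y \<and> fst x > fst y} = ?A \<union> ?B" by auto
  ultimately have len: "perm_length (perm_length n w) (word_perm n w \<rho>) = card ?A + column_inv ?D ?T"
    unfolding word_perm_eq_tab_perm[OF \<rho>] perm_length_tab_perm[OF \<rho>] column_inv_eq_card[OF fin]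
    by simp
  have "column_inv ?D ?T = column_inv ?D (word_tab \<rho>)"
    by (rule column_inv_cong) (simp add: tableau_def w)
  then have sum: "sum_list \<rho> + column_inv ?D ?T = sum_list ?\<pi>"
    using sum_list_plus_column_inv[OF red] sum_list_sy_word[OF p] w by simp
  have "length ?\<pi> = perm_length n w" "length \<rho> = perm_length n w"
    using sy_word_reduced[OF p] \<rho> by (auto simp: reduced_words_def)
  then have "(\<Sum>i = 1..perm_length n w. letter ?\<pi> i) = sum_list ?\<pi>"
    "(\<Sum>i = 1..perm_length n w. letter \<rho> i) = sum_list \<rho>"
    using sum_letters[of ?\<pi>] sum_letters[of \<rho>] by simp_all
  then have "(\<Sum>i = 1..perm_length n w. int (letter ?\<pi> i) - int (letter \<rho> i)) =
      int (sum_list ?\<pi>) - int (sum_list \<rho>)"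
    by (simp add: sum_subtractf flip: of_nat_sum)
  then show ?thesis unfolding word_inv_def tab_inv_def len using sum by simp
qed

section \<open>The poset isomorphism\<close>

text \<open>Every step downwards raises \<open>f\<close> by one, which rules out cycles and gives
  antisymmetry.\<close>

lemma partial_order_on_move_order: "partial_order_on A (move_order A l c b f)"
proof -
  let ?S = "move_step A l c b f"
  have mono: "f y \<le> f x \<and> (f x = f y \<longrightarrow> x = y)" if "(x, y) \<in> ?S\<^sup>*" for x y
    using that
  proof (induction rule: rtrancl_induct)
    case (step y z)
    then have "f y = f z + 1" by (auto simp: move_step_def)
    then show ?case using step.IH by auto
  qed simp
  have "antisym (move_order A l c b f)"
  proof (rule antisymI)
    fix x y assume "(x, y) \<in> move_order A l c b f" "(y, x) \<in> move_order A l c b f"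
    then show "x = y" using mono[of x y] mono[of y x] by (auto simp: move_order_def)
  qed
  moreover have "trans (move_order A l c b f)"
    unfolding move_order_def by (rule transI) (auto intro: rtrancl_trans)
  ultimately show ?thesis
    by (auto simp: partial_order_on_def preorder_on_def refl_on_def move_order_def)
qed

text \<open>Since \<open>\<phi>\<close> intertwines the moves and preserves the inversion number,
  generating steps correspond in both directions; chains in \<open>B\<close> are lifted step by step
  by surjectivity.\<close>

lemma poset_iso_move_order:
  assumes bij: "bij_betw \<phi> A B"
    and f: "\<And>x. x \<in> A \<Longrightarrow> g (\<phi> x) = f x"
    and c: "\<And>i x. x \<in> A \<Longrightarrow> 1 \<le> i \<Longrightarrow> i < l \<Longrightarrow> c i x \<in> A \<and> \<phi> (c i x) = c' i (\<phi> x)"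
    and b: "\<And>i x. x \<in> A \<Longrightarrow> 1 < i \<Longrightarrow> i < l \<Longrightarrow> b i x \<in> A \<and> \<phi> (b i x) = b' i (\<phi> x)"
  shows "poset_iso A (move_order A l c b f) B (move_order B l c' b' g) \<phi>"
proof -
  let ?S = "move_step A l c b f" and ?S' = "move_step B l c' b' g"
  have inj: "\<phi> x = \<phi> y \<longleftrightarrow> x = y" if "x \<in> A" "y \<in> A" for x y
    using bij that by (auto simp: bij_betw_def inj_on_def)
  have mem: "\<phi> x \<in> B" if "x \<in> A" for x using bij that by (auto simp: bij_betw_def)
  have step_iff: "(x, y) \<in> ?S \<longleftrightarrow> (\<phi> x, \<phi> y) \<in> ?S'" if "x \<in> A" "y \<in> A" for x y
  proof -
    have C: "x = c i y \<longleftrightarrow> \<phi> x = c' i (\<phi> y)" if "1 \<le> i" "i < l" for i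
      using c[OF \<open>y \<in> A\<close> that] inj[OF \<open>x \<in> A\<close>, of "c i y"] by auto
    have B: "x = b i y \<longleftrightarrow> \<phi> x = b' i (\<phi> y)" if "1 < i" "i < l" for i
      using b[OF \<open>y \<in> A\<close> that] inj[OF \<open>x \<in> A\<close>, of "b i y"] by auto
    have "(\<exists>i. 1 \<le> i \<and> i < l \<and> x = c i y) \<longleftrightarrow> (\<exists>i. 1 \<le> i \<and> i < l \<and> \<phi> x = c' i (\<phi> y))"
      "(\<exists>i. 1 < i \<and> i < l \<and> x = b i y) \<longleftrightarrow> (\<exists>i. 1 < i \<and> i < l \<and> \<phi> x = b' i (\<phi> y))"
      using C B by blast+
    then show ?thesis
      unfolding move_step_def using that by (simp add: f mem)
  qed
  have "(\<phi> x, \<phi> y) \<in> ?S'\<^sup>*" if "(x, y) \<in> ?S\<^sup>*" for x y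
    using that
  proof (induction rule: rtrancl_induct)
    case (step y z)
    then have "y \<in> A" "z \<in> A" by (auto simp: move_step_def)
    then have "(\<phi> y, \<phi> z) \<in> ?S'" using \<open>(y, z) \<in> ?S\<close> step_iff by blast
    then show ?case using step.IH by (rule rtrancl_into_rtrancl[rotated])
  qed simp
  moreover have "\<exists>y' \<in> A. y = \<phi> y' \<and> (x, y') \<in> ?S\<^sup>*" if "(\<phi> x, y) \<in> ?S'\<^sup>*" "x \<in> A" for x y
    using that(1)
  proof (induction rule: rtrancl_induct)
    case base
    then show ?case using that(2) by blast
  next
    case (step y z)
    then obtain y' where y': "y' \<in> A" "y = \<phi> y'" "(x, y') \<in> ?S\<^sup>*" by blast
    have "z \<in> B" using step.hyps by (auto simp: move_step_def)
    then obtain z' where z': "z' \<in> A" "z = \<phi> z'" using bij by (auto simp: bij_betw_def)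
    then have "(y', z') \<in> ?S" using step.hyps y' step_iff by blast
    then have "(x, z') \<in> ?S\<^sup>*" by (rule rtrancl_into_rtrancl[OF y'(3)])
    then show ?case using z' by blast
  qed
  ultimately have "(x, y) \<in> ?S\<^sup>* \<longleftrightarrow> (\<phi> x, \<phi> y) \<in> ?S'\<^sup>*" if "x \<in> A" "y \<in> A" for x y
    using that inj by metis
  then show ?thesis
    unfolding poset_iso_def using bij mem partial_order_on_move_order[of A l c b f]
      partial_order_on_move_order[of B l c' b' g]
    by (auto simp: move_order_def)
qed

theorem theorem3p21:
  fixes n :: nat and w :: "nat \<Rightarrow> nat"
  assumes "w permutes {1..n}"
  shows "\<exists>\<Phi>. poset_iso (reduced_words n w) (word_order n w) (SBT n w) (tab_order n w) \<Phi> \<and>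
              (\<forall>\<rho> \<in> reduced_words n w. \<forall>T \<in> SBT n w.
                 \<Phi> \<rho> = T \<longleftrightarrow> word_perm n w \<rho> = tab_perm n w T) \<and>
              (\<forall>\<rho> \<in> reduced_words n w. tab_inv (rothe n w) (\<Phi> \<rho>) = word_inv n w \<rho>)"
proof (intro exI[of _ "tableau n"] conjI ballI)
  have len: "length \<rho> = perm_length n w" if "\<rho> \<in> reduced_words n w" for \<rho>
    using that by (simp add: reduced_words_def)
  have surj: "\<exists>\<rho> \<in> reduced_words n w. tableau n \<rho> = T" if "T \<in> SBT n w" for T
    using tableau_surj[OF assms that] .
  have inj: "\<rho> = \<rho>'" if "\<rho> \<in> reduced_words n w" "\<rho>' \<in> reduced_words n w"
    "tab_perm n w (tableau n \<rho>) = tab_perm n w (tableau n \<rho>')" for \<rho> \<rho>'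
    using tab_perm_inj[OF that] .
  have bij: "bij_betw (tableau n) (reduced_words n w) (SBT n w)"
  proof (rule bij_betw_imageI)
    show "inj_on (tableau n) (reduced_words n w)"
      using inj by (metis inj_onI)
    show "tableau n ` reduced_words n w = SBT n w"
      using surj tableau_in_SBT by blast
  qed
  show "poset_iso (reduced_words n w) (word_order n w) (SBT n w) (tab_order n w) (tableau n)"
    unfolding word_order_def tab_order_def
    by (rule poset_iso_move_order[OF bij])
      (simp_all add: tab_inv_eq_word_inv word_c_reduced word_b_reduced len)
  show "tab_inv (rothe n w) (tableau n \<rho>) = word_inv n w \<rho>" if "\<rho> \<in> reduced_words n w" for \<rho>
    using tab_inv_eq_word_inv[OF that] .
  \<comment> \<open>For the converse, \<open>T\<close> is itself the tableau of some reduced word,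
    and equal reading permutations make that word equal to \<open>\<rho>\<close>.\<close>
  show "tableau n \<rho> = T \<longleftrightarrow> word_perm n w \<rho> = tab_perm n w T"
    if "\<rho> \<in> reduced_words n w" "T \<in> SBT n w" for \<rho> T
    using that inj surj word_perm_eq_tab_perm by metis
qed

end
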